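(* Let $P$ be a three-dimensional $L$-type strongly self-dual polyhedron inscribed in the unit sphere centred at the origin, and let $F_0$ be one of its faces, with vertices $x_1,\ldots,x_k$. Then $P$ is uniquely determined up to congruence by $F_0$: if $Q$ is any three-dimensional $L$-type strongly self-dual polyhedron inscribed in the same unit sphere which also has $F_0$ as a face, then $Q$ is congruent to $P$.
   Context: A convex polytope $P\subset\mathbb{R}^3$ is strongly self-dual (ssd) if its vertices lie on the unit sphere $S^2$ centred at the origin $O$, it is circumscribed about the sphere of centre $O$ and radius $r\in(0,1)$ (touching every face), and there is a bijection $\sigma$ from vertices to faces with $\sigma(v)$ orthogonal to $v$ for every vertex $v$. Lovász's construction in $\mathbb{R}^3$: In a plane, let $C$ be the unit circle centred at $O$ and $E$ an ellipse centred at $O$ with axes $2$ and $2r_0$ ($0<r_0<1$), touching $C$ at the endpoints $x,y$ of its major axis. Choose $t$ with $0<t<r_0$ such that an odd polygon $Q=(x_0=x,x_1,\ldots,x_{2k+1}=x)$ can be inscribed in $E$ with all sides tangent to the circle of radius $t$ centred at $O$. Let $\alpha$ be the orthogonal affine map mapping $E$ onto $C$, $y_i=\alpha(x_i)$. Regard $C$ as a meridian of $S^2$ with north pole $x$; let $P_0$ be a regular $l$-gon, $l$ odd, inscribed in the equator. For each vertex $v$ of $P_0$ let $M_v$ be the half-meridian through $v$, and for $i=1,\ldots,k$ let $L_i$ be the parallel through $y_i$; set $u(v,i)=M_v\cap L_i$ and $u(v,0)=x$. The polyhedron $\mathrm{conv}\{u(v,i)\}$ is strongly self-dual; polyhedra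 obtained this way (and their congruent copies) are called $L$-type ssd-polyhedra. *)

theory Defs
  imports "HOL-Analysis.Analysis"
begin

definition isometric_copy :: "(real^3) set \<Rightarrow> (real^3) set \<Rightarrow> bool" where
  "isometric_copy P Q \<longleftrightarrow>
     (\<exists>f :: real^3 \<Rightarrow> real^3. (\<forall>x y. dist (f x) (f y) = dist x y) \<and> f ` P = Q)"

(* Faces are facets, i.e. the two-dimensional ones.  "Circumscribed" means that the sphere
   lies inside P and meets every facet; as r > 0, this makes P three-dimensional. *)
definition strongly_self_dual :: "(real^3) set \<Rightarrow> bool" where
  "strongly_self_dual P \<longleftrightarrow>
     polytope P \<and>
     {v. v extreme_point_of P} \<subseteq> sphere 0 1 \<and>
     (\<exists>r. 0 < r \<and> r < 1 \<and> cball 0 r \<subseteq> P \<and>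
          (\<forall>F. F facet_of P \<longrightarrow> F \<inter> sphere 0 r \<noteq> {})) \<and>
     (\<exists>\<sigma>. bij_betw \<sigma> {v. v extreme_point_of P} {F. F facet_of P} \<and>
          (\<forall>v. v extreme_point_of P \<longrightarrow> (\<forall>y\<in>\<sigma> v. \<forall>z\<in>\<sigma> v. orthogonal v (y - z))))"

definition ellipse :: "real \<Rightarrow> (real^2) set" where
  "ellipse r0 = {z. (z $ 1)\<^sup>2 + (z $ 2 / r0)\<^sup>2 = 1}"

definition to_circle :: "real \<Rightarrow> real^2 \<Rightarrow> real^2" where
  "to_circle r0 z = vector [z $ 1, z $ 2 / r0]"

(* X 0, ..., X (n - 1) are the vertices of a simple closed polygon and X n = X 0. *)
definition simple_polygon :: "nat \<Rightarrow> (nat \<Rightarrow> real^2) \<Rightarrow> bool" where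
  "simple_polygon n X \<longleftrightarrow>
     3 \<le> n \<and> X n = X 0 \<and> inj_on X {..<n} \<and>
     (\<forall>i<n. \<forall>j<n. i \<noteq> j \<longrightarrow>
        closed_segment (X i) (X (Suc i)) \<inter> closed_segment (X j) (X (Suc j)) =
        {X i, X (Suc i)} \<inter> {X j, X (Suc j)})"

definition tangent_side :: "real \<Rightarrow> real^2 \<Rightarrow> real^2 \<Rightarrow> bool" where
  "tangent_side t a b \<longleftrightarrow> (\<exists>z\<in>closed_segment a b. norm z = t \<and> orthogonal z (b - a))"

(* The plane of the ellipse is placed in space as the first two coordinates, so the endpoint
   (1,0) of the major axis becomes the north pole and the equator is where coordinate 1 is 0. *)
definition north_pole :: "real^3" where
  "north_pole = vector [1, 0, 0]"

definition equatorial_polygon :: "nat \<Rightarrow> real \<Rightarrow> (real^3) set" where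
  "equatorial_polygon l \<theta> =
     (\<lambda>j. vector [0, cos (\<theta> + 2 * pi * real j / real l), sin (\<theta> + 2 * pi * real j / real l)])
       ` {..<l}"

definition half_meridian :: "real^3 \<Rightarrow> (real^3) set" where
  "half_meridian v =
     {p \<in> sphere 0 1. \<exists>a b. 0 \<le> b \<and> p = a *\<^sub>R north_pole + b *\<^sub>R v}"

definition parallel_through :: "real^2 \<Rightarrow> (real^3) set" where
  "parallel_through y = {p \<in> sphere 0 1. p $ 1 = y $ 1}"

(* Each intersection below is the single point u(v,i). *)
definition lovasz_hull :: "real \<Rightarrow> nat \<Rightarrow> real \<Rightarrow> nat \<Rightarrow> (nat \<Rightarrow> real^2) \<Rightarrow> (real^3) set" where
  "lovasz_hull r0 l \<theta> k X =
     convex hull (insert north_pole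
       (\<Union>v\<in>equatorial_polygon l \<theta>. \<Union>i\<in>{1..k}.
          half_meridian v \<inter> parallel_through (to_circle r0 (X i))))"

definition lovasz_polyhedron :: "(real^3) set \<Rightarrow> bool" where
  "lovasz_polyhedron P \<longleftrightarrow>
     (\<exists>r0 t k X l \<theta>.
        0 < r0 \<and> r0 < 1 \<and> 0 < t \<and> t < r0 \<and>
        simple_polygon (2 * k + 1) X \<and> X 0 = vector [1, 0] \<and>
        (\<forall>i<2 * k + 1. X i \<in> ellipse r0 \<and> tangent_side t (X i) (X (Suc i))) \<and>
        odd l \<and> 3 \<le> l \<and>
        P = lovasz_hull r0 l \<theta> k X)"

(* Strong self-duality is a separate conjunct because the construction yields it only if r0 is
   the inradius cos (pi / l) of the equatorial polygon; it forces that value of r0. *)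
definition L_type_ssd :: "(real^3) set \<Rightarrow> bool" where
  "L_type_ssd P \<longleftrightarrow>
     strongly_self_dual P \<and> (\<exists>P'. lovasz_polyhedron P' \<and> isometric_copy P' P)"

end

theory Submission
  imports Defs
begin

text \<open>In a strongly self-dual polyhedron with inradius \<open>r\<close>, the facet dual to the vertex \<open>v\<close> must
  lie in the plane \<open>v \<bullet> x = - r\<close>.  For the convex hull of an apex and of regular \<open>l\<close>-gons on
  parallels this leaves three kinds of facets: triangles at the apex, trapezoids between
  consecutive parallels, and the base.  Cut by the plane through the axis and an edge midpoint of
  the equatorial polygon, consecutive parallels become points of an ellipse, with semi-axes \<open>1\<close> and
  \<open>cos (pi / l)\<close>, joined by a tangent to the circle of radius \<open>r\<close>; hence \<open>l\<close> and \<open>r\<close> determine all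
  the parallels, and the polygon \<open>X\<close> of the construction is not needed any more.  The number \<open>r\<close> is
  the distance of \<open>F0\<close> from the origin.  The number \<open>l\<close> can be read off from \<open>F0\<close>: from the number
  of vertices of a base, and from the scalar products of the vertices of a triangle or trapezoid,
  where rectangles are impossible because the dual vertex would lie between consecutive parallels.
  The only ambiguous case, an equilateral triangle that is a base for \<open>l = 3\<close>, has
  \<open>r \<le> cos (pi / 3)\<close>, so as a triangle at an apex it has an obtuse central angle, whence \<open>l = 3\<close>
  again.\<close>

section \<open>Polytopes inscribed in the unit sphere\<close>

text \<open>Strict convexity of the ball: if b = u a + (1 - u) c, comparing the squared norms leaves
  u (1 - u) (a \<bullet> c - 1) = 0, and each factor forces two of the points to coincide.\<close>

lemma sphere_not_collinear:
  fixes a b c :: "'a::euclidean_space"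
  assumes "norm a = 1" "norm b = 1" "norm c = 1" "a \<noteq> b" "b \<noteq> c" "a \<noteq> c"
  shows "\<not> collinear {a, b, c}"
proof
  assume "collinear {a, b, c}"
  then obtain u where u: "b = u *\<^sub>R a + (1 - u) *\<^sub>R c"
    using assms(6) by (auto simp: collinear_3_expand)
  have sq: "a \<bullet> a = 1" "b \<bullet> b = 1" "c \<bullet> c = 1"
    using assms by (simp_all add: norm_eq_sqrt_inner)
  have "b \<bullet> b = u * u * (a \<bullet> a) + 2 * u * (1 - u) * (a \<bullet> c) + (1 - u) * (1 - u) * (c \<bullet> c)"
    unfolding u by (simp add: inner_add_left inner_add_right inner_commute algebra_simps)
  then have "u * (1 - u) * (a \<bullet> c - 1) = 0"
    using sq by (simp add: algebra_simps)
  moreover have "a \<bullet> c \<noteq> 1"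
  proof
    assume "a \<bullet> c = 1"
    then have "(a - c) \<bullet> (a - c) = 0"
      using sq by (simp add: inner_diff_left inner_diff_right inner_commute)
    then show False using assms by simp
  qed
  ultimately show False using u assms by auto
qed

lemma sphere_aff_dim_ge_2:
  fixes S :: "'a::euclidean_space set"
  assumes "{a, b, c} \<subseteq> S" "norm a = 1" "norm b = 1" "norm c = 1" "a \<noteq> b" "b \<noteq> c" "a \<noteq> c"
  shows "2 \<le> aff_dim S"
  using sphere_not_collinear[OF assms(2-)] aff_dim_subset[OF assms(1)]
  by (auto simp: collinear_aff_dim)

lemma inner_eq_1_imp_eq:
  fixes a b :: "'a::real_inner"
  assumes "norm a \<le> 1" "norm b \<le> 1" "a \<bullet> b = 1"
  shows "a = b"
proof -
  have "a \<bullet> a \<le> 1" "b \<bullet> b \<le> 1" using assms by (simp_all add: norm_eq_sqrt_inner)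
  then have "(a - b) \<bullet> (a - b) \<le> 0"
    using assms(3) by (simp add: inner_diff_left inner_diff_right inner_commute)
  then show ?thesis by (metis eq_iff_diff_eq_0 inner_ge_zero inner_eq_zero_iff order_antisym)
qed

text \<open>If a unit vector v lies inside a segment from a to b in the ball, then 1 = v \<bullet> v
  is a proper convex combination of a \<bullet> v and b \<bullet> v, both at most 1; so a = v = b.
  Hence the vertices of a face are just its unit vectors, which is why
  \<open>F \<inter> sphere 0 1\<close> stands for them below.\<close>

lemma extreme_points_hull_sphere:
  fixes V :: "'a::euclidean_space set"
  assumes "V \<subseteq> sphere 0 1"
  shows "{v. v extreme_point_of (convex hull V)} = V"
    and "convex hull V \<inter> sphere 0 1 = V"
proof -
  have sub: "convex hull V \<subseteq> cball 0 1"
    by (rule hull_minimal) (use assms in auto)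
  have ext: "v extreme_point_of (convex hull V)" if v: "v \<in> convex hull V \<inter> sphere 0 1" for v
    unfolding extreme_point_of_def
  proof (intro conjI ballI notI)
    show "v \<in> convex hull V" using v by simp
    fix a b assume "a \<in> convex hull V" "b \<in> convex hull V" and seg: "v \<in> open_segment a b"
    then have ab: "norm a \<le> 1" "norm b \<le> 1" using sub by auto
    have nv: "norm v = 1" using v by simp
    obtain u where u: "0 < u" "u < 1" "v = (1 - u) *\<^sub>R a + u *\<^sub>R b" and "a \<noteq> b"
      using seg by (auto simp: in_segment)
    have le: "a \<bullet> v \<le> 1" "b \<bullet> v \<le> 1"
      using norm_cauchy_schwarz[of a v] norm_cauchy_schwarz[of b v] ab nv by auto
    have "v \<bullet> v = (1 - u) * (a \<bullet> v) + u * (b \<bullet> v)"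
      by (subst (1) u(3)) (simp add: inner_add_left)
    then have eq: "(1 - u) * (1 - a \<bullet> v) + u * (1 - b \<bullet> v) = 0"
      using nv by (simp add: dot_square_norm algebra_simps)
    have "0 \<le> (1 - u) * (1 - a \<bullet> v)" "0 \<le> u * (1 - b \<bullet> v)" using u le by auto
    then have "(1 - u) * (1 - a \<bullet> v) = 0" "u * (1 - b \<bullet> v) = 0" using eq by linarith+
    then have "a \<bullet> v = 1" "b \<bullet> v = 1" using u by auto
    then have "a = v" "b = v" using inner_eq_1_imp_eq[of _ v] ab nv by auto
    then show False using \<open>a \<noteq> b\<close> by simp
  qed
  show "{v. v extreme_point_of (convex hull V)} = V"
    using ext assms hull_subset[of V convex] by (fastforce dest: extreme_point_of_convex_hull)
  show "convex hull V \<inter> sphere 0 1 = V"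
    using ext assms hull_subset[of V convex] by (fastforce dest: extreme_point_of_convex_hull)
qed

lemma face_of_hull_sphere:
  fixes V :: "'a::euclidean_space set"
  assumes "finite V" "V \<subseteq> sphere 0 1" "F face_of (convex hull V)"
  shows "F = convex hull (F \<inter> sphere 0 1)"
proof -
  obtain S where S: "S \<subseteq> V" "F = convex hull S"
    using face_of_convex_hull_subset[OF finite_imp_compact[OF assms(1)] assms(3)] by blast
  then have "S \<subseteq> sphere 0 1" using assms by auto
  from extreme_points_hull_sphere(2)[OF this] show ?thesis using S by auto
qed

text \<open>The ball of radius r inside P makes the plane of each facet orthogonal to its touching
  point z. Orthogonality of v to the facet \<open>\<sigma> v\<close> then makes v a multiple of z,
  so v = z / r or v = - z / r, and only the second sign is compatible with v lying in P.\<close>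

lemma ssd_facets:
  fixes P :: "(real^3) set"
  assumes ssd: "strongly_self_dual P" and fin: "finite V" and V: "V \<subseteq> sphere 0 1"
    and P: "P = convex hull V"
  obtains r where "0 < r" "r < 1" "cball 0 r \<subseteq> P"
    "\<And>v x. v \<in> V \<Longrightarrow> x \<in> P \<Longrightarrow> - r \<le> v \<bullet> x"
    "\<And>v. v \<in> V \<Longrightarrow> (P \<inter> {x. v \<bullet> x = - r}) facet_of P"
    "\<And>F. F facet_of P \<Longrightarrow> \<exists>v\<in>V. F = P \<inter> {x. v \<bullet> x = - r}"
    "\<And>F. F facet_of P \<Longrightarrow> \<exists>x\<in>F. norm x = r"
proof -
  have ext: "{v. v extreme_point_of P} = V"
    unfolding P by (rule extreme_points_hull_sphere[OF V])
  obtain r \<sigma> where r: "0 < r" "r < 1" "cball 0 r \<subseteq> P"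
      and touch: "\<And>F. F facet_of P \<Longrightarrow> F \<inter> sphere 0 r \<noteq> {}"
      and \<sigma>: "bij_betw \<sigma> V {F. F facet_of P}"
      and orth: "\<And>v y z. v \<in> V \<Longrightarrow> y \<in> \<sigma> v \<Longrightarrow> z \<in> \<sigma> v \<Longrightarrow> orthogonal v (y - z)"
    using ssd unfolding strongly_self_dual_def ext[symmetric] by auto
  have dimP: "aff_dim P = 3"
    using aff_dim_subset[OF r(3)] aff_dim_le_DIM[of P] aff_dim_cball[of r "0::real^3"] r(1) by simp
  have poly: "polyhedron P" using ssd polytope_imp_polyhedron strongly_self_dual_def by blast
  have key: "(\<forall>x\<in>P. - r \<le> v \<bullet> x) \<and> \<sigma> v = P \<inter> {x. v \<bullet> x = - r}" if v: "v \<in> V" for v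
  proof -
    have F: "\<sigma> v facet_of P" using bij_betwE[OF \<sigma>] v by auto
    obtain n d where n: "n \<noteq> 0" "P \<subseteq> {x. n \<bullet> x \<le> d}" "\<sigma> v = P \<inter> {x. n \<bullet> x = d}"
      using facet_of_polyhedron[OF poly F] .
    obtain z where z: "z \<in> \<sigma> v" "norm z = r" using touch[OF F] by fastforce
    \<comment> \<open>The point of the ball in direction n gives \<open>norm n * r \<le> d\<close>;
      Cauchy-Schwarz at z gives the converse, and its equality case makes n parallel to z.\<close>
    have "(r / norm n) *\<^sub>R n \<in> P" using r n(1) by auto
    then have "n \<bullet> ((r / norm n) *\<^sub>R n) \<le> d" using n(2) by blast
    then have "norm n * r \<le> d"
      using n(1) by (simp add: dot_square_norm power2_eq_square mult.commute)
    moreover have "n \<bullet> z = d" using z n(3) by auto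
    moreover have "n \<bullet> z \<le> norm n * norm z" by (rule norm_cauchy_schwarz)
    ultimately have d: "d = norm n * r" and "n \<bullet> z = norm n * norm z" using z by auto
    then have "norm n *\<^sub>R z = r *\<^sub>R n" using norm_cauchy_schwarz_eq[of n z] z by simp
    then have zn: "n = (norm n / r) *\<^sub>R z"
    proof -
      have "(1 / r) *\<^sub>R (r *\<^sub>R n) = (1 / r) *\<^sub>R (norm n *\<^sub>R z)"
        using \<open>norm n *\<^sub>R z = r *\<^sub>R n\<close> by simp
      then show ?thesis using r(1) by simp
    qed
    have hyp: "affine hull (\<sigma> v) = {x. n \<bullet> x = d}"
    proof (rule affine_dim_equal)
      show "affine hull \<sigma> v \<subseteq> {x. n \<bullet> x = d}"
        by (rule hull_minimal) (use n affine_hyperplane in auto)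
      show "aff_dim (affine hull \<sigma> v) = aff_dim {x. n \<bullet> x = d}"
        using F n(1) dimP by (simp add: facet_of_def)
    qed (use z affine_hyperplane in auto)
    have "affine hull (\<sigma> v) \<subseteq> {x. v \<bullet> x = v \<bullet> z}"
      by (rule hull_minimal)
        (use orth[OF v _ z(1)] affine_hyperplane in \<open>auto simp: orthogonal_def inner_diff_right\<close>)
    then have par: "v \<bullet> x = v \<bullet> z" if "n \<bullet> x = d" for x using hyp that by auto
    \<comment> \<open>q is the component of v orthogonal to z. Moving from z by q stays in the plane
      of the facet, on which v is constant, so q is orthogonal to v as well and therefore
      zero.\<close>
    define q where "q = v - ((v \<bullet> z) / r\<^sup>2) *\<^sub>R z"
    have zz: "z \<bullet> z = r\<^sup>2" using z by (simp add: dot_square_norm)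
    have zq: "z \<bullet> q = 0" using zz r by (simp add: q_def inner_diff_right inner_commute)
    have "n \<bullet> q = 0" by (subst zn) (simp add: zq)
    then have "v \<bullet> (z + q) = v \<bullet> z"
      using par[of "z + q"] \<open>n \<bullet> z = d\<close> by (simp only: inner_add_right add_0_right)
    then have "v \<bullet> q = 0" by (simp add: inner_add_right)
    then have "q \<bullet> q = 0" using zq by (subst (1) q_def) (simp only: inner_diff_left inner_scaleR_left mult_zero_right diff_0_right)
    then have vz: "v = ((v \<bullet> z) / r\<^sup>2) *\<^sub>R z" by (simp add: q_def)
    have nv: "norm v = 1" using v V by auto
    define \<mu> where "\<mu> = v \<bullet> z / r\<^sup>2"
    have v\<mu>: "v = \<mu> *\<^sub>R z" using vz by (simp add: \<mu>_def)
    have "norm v = \<bar>\<mu>\<bar> * norm z" by (subst v\<mu>) simp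
    then have "\<bar>\<mu>\<bar> * r = 1" using nv z by simp
    then have "\<mu> = 1 / r \<or> \<mu> = - (1 / r)" using r by (auto simp: field_simps abs_if split: if_splits)
    have zP: "z \<bullet> x \<le> r\<^sup>2 \<and> (z \<bullet> x = r\<^sup>2 \<longleftrightarrow> x \<in> \<sigma> v)" if "x \<in> P" for x
    proof -
      have "n \<bullet> x = norm n / r * (z \<bullet> x)" by (subst zn) simp
      moreover have "d = norm n / r * r\<^sup>2" using r d by (simp add: power2_eq_square)
      moreover have "0 < norm n / r" using n r by simp
      ultimately have "n \<bullet> x \<le> d \<longleftrightarrow> z \<bullet> x \<le> r\<^sup>2" "n \<bullet> x = d \<longleftrightarrow> z \<bullet> x = r\<^sup>2"
        by (metis mult_le_cancel_left_pos, metis less_irrefl mult_cancel_left)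
      then show ?thesis using n(2,3) that by auto
    qed
    have "v \<in> P" using v P hull_subset by fast
    \<comment> \<open>With the positive sign z \<bullet> v would be r, beyond the bound r^2 < r that
      holds on P.\<close>
    have "\<mu> \<noteq> 1 / r"
    proof
      assume "\<mu> = 1 / r"
      then have "z \<bullet> v = r" by (subst v\<mu>) (use zz r in \<open>simp add: power2_eq_square\<close>)
      moreover have "z \<bullet> v \<le> r\<^sup>2" using zP \<open>v \<in> P\<close> by auto
      ultimately show False using r by (simp add: power2_eq_square)
    qed
    then have "\<mu> = - (1 / r)" using \<open>\<mu> = 1 / r \<or> \<mu> = - (1 / r)\<close> by simp
    then have "v \<bullet> x = - (z \<bullet> x / r)" for x by (subst v\<mu>) simp
    then have "r\<^sup>2 - z \<bullet> x = r * (v \<bullet> x + r)" for x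
      using r by (simp add: field_simps power2_eq_square)
    then have "v \<bullet> x + r = 0 \<longleftrightarrow> r\<^sup>2 - z \<bullet> x = 0" "0 \<le> v \<bullet> x + r \<longleftrightarrow> 0 \<le> r\<^sup>2 - z \<bullet> x" for x
      using r by (simp_all add: zero_le_mult_iff)
    then have vx: "v \<bullet> x = - r \<longleftrightarrow> z \<bullet> x = r\<^sup>2" "- r \<le> v \<bullet> x \<longleftrightarrow> z \<bullet> x \<le> r\<^sup>2" for x
      by (smt (verit))+
    have "\<sigma> v \<subseteq> P" using F facet_of_imp_subset by blast
    then show ?thesis using zP vx by auto
  qed
  show thesis
  proof (rule that[OF r])
    show "\<And>v x. v \<in> V \<Longrightarrow> x \<in> P \<Longrightarrow> - r \<le> v \<bullet> x" using key by auto
    show "(P \<inter> {x. v \<bullet> x = - r}) facet_of P" if "v \<in> V" for v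
      using key[OF that] bij_betwE[OF \<sigma>] that by auto
    show "\<exists>v\<in>V. F = P \<inter> {x. v \<bullet> x = - r}" if "F facet_of P" for F
      using that \<sigma> key by (metis (mono_tags, lifting) bij_betw_imp_surj_on imageE mem_Collect_eq)
    show "\<exists>x\<in>F. norm x = r" if "F facet_of P" for F using touch[OF that] by auto
  qed
qed

section \<open>Tangents to a circle from points of an ellipse\<close>

text \<open>For odd \<open>l\<close> this makes each vertex of a regular \<open>l\<close>-gon opposite to an edge.\<close>

lemma cos_odd_multiple:
  fixes k :: int and l :: nat
  assumes "2 \<le> l"
  shows "cos (pi * (2 * k - 1) / l) \<le> cos (pi / l)"
    and "cos (pi * (2 * k - 1) / l) = cos (pi / l) \<Longrightarrow> k mod l = 0 \<or> k mod l = 1"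
proof -
  define m where "m = k mod int l"
  have m: "0 \<le> m" "m < l" using assms by (simp_all add: m_def)
  have k: "k = m + l * (k div l)" by (simp add: m_def)
  have "pi * (2 * k - 1) / l = pi * (2 * m - 1) / l + 2 * pi * of_int (k div l)"
    using assms by (subst k) (simp add: field_simps)
  then have per: "cos (pi * (2 * k - 1) / l) = cos (pi * (2 * m - 1) / l)"
    by (simp add: cos_add)
  \<comment> \<open>Once k is reduced to a residue m, the difference is a product of two sines: both
    are nonnegative for m at least 1, and the first vanishes for m = 0.\<close>
  have "cos (pi / l) - cos (pi * (2 * m - 1) / l) = 2 * sin (pi * m / l) * sin (pi * (m - 1) / l)"
  proof -
    have "(pi / l + pi * (2 * m - 1) / l) / 2 = pi * m / l"
      "(pi * (2 * m - 1) / l - pi / l) / 2 = pi * (m - 1) / l"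
      using assms by (simp_all add: field_simps)
    then show ?thesis by (simp only: cos_diff_cos)
  qed
  moreover have "0 \<le> sin (pi * m / l) * sin (pi * (m - 1) / l)
      \<and> (sin (pi * m / l) * sin (pi * (m - 1) / l) = 0 \<longrightarrow> m = 0 \<or> m = 1)"
  proof (cases "m = 0")
    case False
    have "0 < sin (pi * m / l)"
      by (rule sin_gt_zero) (use m False assms in \<open>auto simp: field_simps\<close>)
    moreover have "0 < sin (pi * (m - 1) / l)" if "m \<noteq> 1"
    proof (rule sin_gt_zero)
      have "real_of_int m - 1 < l" using m by linarith
      then have "pi * (real_of_int m - 1) < pi * l" by simp
      then show "pi * (m - 1) / l < pi" using assms by (simp add: field_simps)
    qed (use m False assms that in \<open>auto simp: field_simps\<close>)
    ultimately show ?thesis using False by (cases "m = 1") auto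
  qed simp
  ultimately show "cos (pi * (2 * k - 1) / l) \<le> cos (pi / l)"
    "cos (pi * (2 * k - 1) / l) = cos (pi / l) \<Longrightarrow> k mod l = 0 \<or> k mod l = 1"
    unfolding per m_def[symmetric] by auto
qed

text \<open>Positivity of \<beta> puts the phase M strictly between 0 and pi, so \<psi> - M stays
  within [-pi, pi] for \<psi> in [0, pi]; there two angles with the same cosine are equal or
  opposite.\<close>

lemma sinusoid_polar:
  fixes \<alpha> \<beta> :: real
  assumes "0 < \<beta>"
  obtains R M where "0 < R" "0 < M" "M < pi"
    "\<And>\<psi>. \<alpha> * cos \<psi> + \<beta> * sin \<psi> = R * cos (\<psi> - M)"
proof -
  define R where "R = sqrt (\<alpha>\<^sup>2 + \<beta>\<^sup>2)"
  define M where "M = arccos (\<alpha> / R)"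
  have R: "0 < R" "R\<^sup>2 = \<alpha>\<^sup>2 + \<beta>\<^sup>2"
    using assms by (simp_all add: R_def add_nonneg_pos)
  have "\<alpha>\<^sup>2 < R\<^sup>2" using R assms by simp
  then have "\<bar>\<alpha>\<bar> < R" using R(1) by (metis abs_le_square_iff abs_of_pos not_le)
  then have a: "-1 < \<alpha> / R" "\<alpha> / R < 1" using R(1) by (auto simp: field_simps)
  then have M: "0 < M" "M < pi" "cos M = \<alpha> / R"
    using arccos_lt_bounded[of "\<alpha> / R"] by (auto simp: M_def)
  have "sin M = sqrt (1 - (\<alpha> / R)\<^sup>2)" using a by (simp add: M_def sin_arccos)
  also have "1 - (\<alpha> / R)\<^sup>2 = (\<beta> / R)\<^sup>2"
  proof -
    have "1 - (\<alpha> / R)\<^sup>2 = (R\<^sup>2 - \<alpha>\<^sup>2) / R\<^sup>2"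
      using R(1) by (simp add: power_divide diff_divide_distrib)
    then show ?thesis using R(2) by (simp add: power_divide)
  qed
  finally have "sin M = \<beta> / R" using assms R(1) by simp
  then have "\<alpha> = R * cos M" "\<beta> = R * sin M" using M(3) R(1) by simp_all
  then have "\<alpha> * cos \<psi> + \<beta> * sin \<psi> = R * cos (\<psi> - M)" for \<psi>
    by (simp add: cos_diff algebra_simps)
  then show thesis using that R(1) M by blast
qed

lemma cos_diff_eq_cases:
  assumes "cos (A - M) = cos (B - M)" "A \<in> {0..pi}" "B \<in> {0..pi}" "0 < M" "M < pi"
  shows "A = B \<or> A + B = 2 * M"
proof -
  have "cos \<bar>A - M\<bar> = cos \<bar>B - M\<bar>" using assms(1) by (simp only: cos_abs_real)
  moreover have "\<bar>A - M\<bar> \<le> pi" "\<bar>B - M\<bar> \<le> pi" using assms by auto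
  ultimately have "\<bar>A - M\<bar> = \<bar>B - M\<bar>" using cos_inj_pi by simp
  then show ?thesis by linarith
qed

text \<open>A line meets a half-ellipse at most twice: two different solutions are mirror images in
  the phase M, so a third one would coincide with one of them.\<close>

lemma sinusoid_level_3:
  fixes \<alpha> \<beta> r :: real
  assumes "0 < \<beta>" "{A, B, C} \<subseteq> {0..pi}"
    and "\<alpha> * cos A + \<beta> * sin A = r" "\<alpha> * cos B + \<beta> * sin B = r" "\<alpha> * cos C + \<beta> * sin C = r"
  shows "A = B \<or> B = C \<or> A = C"
proof -
  obtain R M where "0 < R" "0 < M" "M < pi"
    "\<And>\<psi>. \<alpha> * cos \<psi> + \<beta> * sin \<psi> = R * cos (\<psi> - M)"
    using sinusoid_polar[OF assms(1)] by metis
  then show ?thesis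
    using assms cos_diff_eq_cases[of A M B] cos_diff_eq_cases[of B M C] by auto
qed

lemma sinusoid_between:
  fixes \<alpha> \<beta> r :: real
  assumes "0 < \<beta>" "0 \<le> A" "A < C" "C < B" "B \<le> pi"
    and "\<alpha> * cos A + \<beta> * sin A = r" "\<alpha> * cos B + \<beta> * sin B = r"
  shows "r < \<alpha> * cos C + \<beta> * sin C"
proof -
  obtain R M where RM: "0 < R" "0 < M" "M < pi"
    "\<And>\<psi>. \<alpha> * cos \<psi> + \<beta> * sin \<psi> = R * cos (\<psi> - M)"
    using sinusoid_polar[OF assms(1)] by metis
  then have "A + B = 2 * M"
    using assms cos_diff_eq_cases[of A M B] by auto
  then have "cos (B - M) < cos \<bar>C - M\<bar>"
    by (intro cos_monotone_0_pi) (use assms RM in auto)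
  then show ?thesis using RM assms(7) by auto
qed

text \<open>With \<open>c = cos (pi / l)\<close>, this is how far in the direction opposite to a vertex at polar angle
  \<open>\<phi>\<close> the edge midpoint at polar angle \<open>\<psi>\<close> on the opposite side lies.\<close>

definition height :: "real \<Rightarrow> real \<Rightarrow> real \<Rightarrow> real" where
  "height c \<phi> \<psi> = - cos \<phi> * cos \<psi> + c * sin \<phi> * sin \<psi>"

lemma height_commute: "height c \<phi> \<psi> = height c \<psi> \<phi>"
  by (simp add: height_def)

lemma height_level_3:
  assumes "0 < c" "0 < \<phi>" "\<phi> < pi" "{A, B, C} \<subseteq> {0..pi}"
    and "height c \<phi> A = r" "height c \<phi> B = r" "height c \<phi> C = r"
  shows "A = B \<or> B = C \<or> A = C"
  using sinusoid_level_3[of "c * sin \<phi>" A B C "- cos \<phi>" r] assms sin_gt_zero[of \<phi>]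
  by (simp add: height_def)

lemma height_between:
  assumes "0 < c" "0 < \<phi>" "\<phi> < pi" "0 \<le> A" "A < C" "C < B" "B \<le> pi"
    and "height c \<phi> A = r" "height c \<phi> B = r"
  shows "r < height c \<phi> C"
  using sinusoid_between[of "c * sin \<phi>" A C B "- cos \<phi>" r] assms sin_gt_zero[of \<phi>]
  by (simp add: height_def)

text \<open>The numbers in \<Phi> parametrise points (cos \<psi>, c sin \<psi>) of an ellipse. For r
  > 0, consecutive ones, starting from the apex at angle 0, lie on a line with unit normal (- cos
  \<phi>, sin \<phi>) tangent to the circle of radius r. The condition on m ends the chain at the
  tangent whose first coordinate is - r.\<close>

definition tangent_angles :: "real \<Rightarrow> real \<Rightarrow> real set \<Rightarrow> bool" where
  "tangent_angles c r \<Phi> \<longleftrightarrow> finite \<Phi> \<and> \<Phi> \<subseteq> {0<..<pi} \<and>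
     (\<exists>m\<in>\<Phi>. cos m = - r \<and> (\<forall>\<psi>\<in>\<Phi>. \<psi> \<le> m)) \<and>
     (\<forall>A\<in>insert 0 \<Phi>. \<forall>B\<in>\<Phi>. A < B \<longrightarrow> (\<forall>\<psi>\<in>\<Phi>. \<psi> \<le> A \<or> B \<le> \<psi>) \<longrightarrow>
        (\<exists>\<phi>. 0 < \<phi> \<and> \<phi> < pi \<and> height c \<phi> A = r \<and> height c \<phi> B = r))"

lemma exists_predecessor:
  fixes S :: "'a::linorder set"
  assumes "finite S" "B \<in> S" "a \<in> S" "a < B"
  obtains A where "A \<in> S" "A < B" "\<forall>x\<in>S. x \<le> A \<or> B \<le> x" "a \<le> A"
proof
  let ?T = "{x \<in> S. x < B}"
  have T: "finite ?T" "a \<in> ?T" using assms by auto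
  have "Max ?T \<in> ?T" using T by (intro Max_in) auto
  then show "Max ?T \<in> S" "Max ?T < B" by auto
  show "a \<le> Max ?T" using T by simp
  show "\<forall>x\<in>S. x \<le> Max ?T \<or> B \<le> x" using T(1) by (metis (mono_tags, lifting) Max_ge mem_Collect_eq not_le)
qed

lemma exists_successor:
  fixes S :: "'a::linorder set"
  assumes "finite S" "b \<in> S" "A < b"
  obtains B where "B \<in> S" "A < B" "\<forall>x\<in>S. x \<le> A \<or> B \<le> x"
proof
  let ?T = "{x \<in> S. A < x}"
  have T: "finite ?T" "b \<in> ?T" using assms by auto
  have "Min ?T \<in> ?T" using T by (intro Min_in) auto
  then show "Min ?T \<in> S" "A < Min ?T" by auto
  show "\<forall>x\<in>S. x \<le> A \<or> Min ?T \<le> x" using T(1) by (metis (mono_tags, lifting) Min_le mem_Collect_eq not_le)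
qed

text \<open>Through a point outside the circle of radius \<open>r\<close> pass only two tangents, and one of them
  belongs to the preceding angle; so each angle determines its successor.\<close>

lemma tangent_angles_step:
  assumes c: "0 < c" and 1: "tangent_angles c r \<Phi>" and 2: "tangent_angles c r \<Phi>'"
    and B: "B \<in> \<Phi>" "B \<notin> \<Phi>'" and agree: "\<And>x. x < B \<Longrightarrow> x \<in> \<Phi> \<longleftrightarrow> x \<in> \<Phi>'"
  shows False
proof -
  have fin: "finite (insert 0 \<Phi>)" "finite \<Phi>'" and sub: "\<Phi> \<subseteq> {0<..<pi}" "\<Phi>' \<subseteq> {0<..<pi}"
    using 1 2 by (auto simp: tangent_angles_def)
  have step: "\<exists>\<phi>. 0 < \<phi> \<and> \<phi> < pi \<and> height c \<phi> A = r \<and> height c \<phi> B = r"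
    if "A \<in> insert 0 \<Phi>" "B \<in> \<Phi>" "A < B" "\<forall>x\<in>insert 0 \<Phi>. x \<le> A \<or> B \<le> x" for A B
    using 1 that unfolding tangent_angles_def by auto
  have "B \<in> insert 0 \<Phi>" "0 \<in> insert 0 \<Phi>" "0 < B" using B sub by auto
  from exists_predecessor[OF fin(1) this]
  obtain A where A: "A \<in> insert 0 \<Phi>" "A < B" "\<forall>x\<in>insert 0 \<Phi>. x \<le> A \<or> B \<le> x" "0 \<le> A" .
  have A': "A \<in> insert 0 \<Phi>'" using A agree by auto
  have Api: "A < pi" "0 < B" "B < pi" using A B sub by auto
  obtain \<phi> where \<phi>: "0 < \<phi>" "\<phi> < pi" "height c \<phi> A = r" "height c \<phi> B = r"
    using step[OF A(1) B(1) A(2,3)] by auto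
  show False
  proof (cases "\<exists>b\<in>\<Phi>'. A < b")
    case True
    then obtain b where "b \<in> \<Phi>'" "A < b" by auto
    from exists_successor[OF fin(2) this]
    obtain B' where B': "B' \<in> \<Phi>'" "A < B'" "\<forall>x\<in>\<Phi>'. x \<le> A \<or> B' \<le> x" .
    have "B \<noteq> B'" "B' < pi" using B B' sub by auto
    obtain \<phi>' where \<phi>': "0 < \<phi>'" "\<phi>' < pi" "height c \<phi>' A = r" "height c \<phi>' B' = r"
      using 2 A' B' unfolding tangent_angles_def by blast
    \<comment> \<open>Both tangents pass through the point at A. For A = 0 the height is - cos
      \<phi>, which fixes \<phi>; otherwise the tangent \<phi>0 coming from the predecessor of A is
      a third one to compare with.\<close>
    have "\<phi> = \<phi>'"
    proof (cases "A = 0")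
      case True
      then have "cos \<phi> = cos \<phi>'" using \<phi> \<phi>' by (simp add: height_def)
      then show ?thesis using cos_inj_pi \<phi> \<phi>' by simp
    next
      case False
      then have "A \<in> \<Phi>" "0 < A" using A by auto
      have "0 \<in> insert 0 \<Phi>" by simp
      from exists_predecessor[OF fin(1) A(1) this \<open>0 < A\<close>]
      obtain A0 where A0: "A0 \<in> insert 0 \<Phi>" "A0 < A" "\<forall>x\<in>insert 0 \<Phi>. x \<le> A0 \<or> A \<le> x" "0 \<le> A0" .
      obtain \<phi>0 where \<phi>0: "0 < \<phi>0" "\<phi>0 < pi" "height c \<phi>0 A0 = r" "height c \<phi>0 A = r"
        using step[OF A0(1) \<open>A \<in> \<Phi>\<close> A0(2,3)] by auto
      have "\<phi>0 \<noteq> \<phi>"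
        using height_level_3[OF c \<phi>0(1,2), of A0 A B r] \<phi>0 \<phi> A A0 Api by auto
      moreover have "\<phi>0 \<noteq> \<phi>'"
        using height_level_3[OF c \<phi>0(1,2), of A0 A B' r] \<phi>0 \<phi>' A A0 B' Api \<open>B' < pi\<close> by auto
      \<comment> \<open>By the symmetry of \<open>height\<close>, the bound of two points on a line
        also says that at most two tangents pass through the point at A.\<close>
      moreover have "\<phi>0 = \<phi> \<or> \<phi> = \<phi>' \<or> \<phi>0 = \<phi>'"
        by (rule height_level_3[OF c \<open>0 < A\<close> \<open>A < pi\<close>])
          (use \<phi> \<phi>' \<phi>0 in \<open>auto simp: height_commute[of c A]\<close>)
      ultimately show ?thesis by auto
    qed
    then show False
      using height_level_3[OF c \<phi>(1,2), of A B B' r] \<phi> \<phi>' A B' Api \<open>B \<noteq> B'\<close> \<open>B' < pi\<close> by auto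
  next
    case False
    obtain m where m: "m \<in> \<Phi>" "cos m = - r" "\<forall>\<psi>\<in>\<Phi>. \<psi> \<le> m"
      using 1 by (auto simp: tangent_angles_def)
    obtain m' where m': "m' \<in> \<Phi>'" "cos m' = - r"
      using 2 by (auto simp: tangent_angles_def)
    \<comment> \<open>If \<Phi>' stops at A, its last angle m' is smaller than the last angle m of
      \<Phi>, although both have cosine - r.\<close>
    have "m' \<le> A" using False m' by auto
    then have "m' < m" using A m B by force
    moreover have "0 \<le> m" "m \<le> pi" "0 \<le> m'" "m' \<le> pi" using m m' sub by auto
    then have "m' = m" using cos_inj_pi[of m' m] m m' by simp
    ultimately show False by simp
  qed
qed

text \<open>The least angle lying in only one of the sets would be a new successor after a common
  initial part, which \<open>tangent_angles_step\<close> excludes.\<close>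

lemma tangent_angles_unique:
  assumes c: "0 < c" and 1: "tangent_angles c r \<Phi>" and 2: "tangent_angles c r \<Phi>'"
  shows "\<Phi> = \<Phi>'"
proof (rule ccontr)
  assume "\<Phi> \<noteq> \<Phi>'"
  define D where "D = (\<Phi> - \<Phi>') \<union> (\<Phi>' - \<Phi>)"
  have D: "finite D" "D \<noteq> {}"
    using 1 2 \<open>\<Phi> \<noteq> \<Phi>'\<close> by (auto simp: tangent_angles_def D_def)
  then have B: "Min D \<in> D" by (rule Min_in)
  have "x \<notin> D" if "x < Min D" for x using that D(1) by (meson Min_le not_le)
  then have agree: "x < Min D \<Longrightarrow> x \<in> \<Phi> \<longleftrightarrow> x \<in> \<Phi>'" for x by (auto simp: D_def)
  have "Min D \<in> \<Phi> \<and> Min D \<notin> \<Phi>' \<or> Min D \<in> \<Phi>' \<and> Min D \<notin> \<Phi>"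
    using B by (auto simp: D_def)
  then show False
    using tangent_angles_step[OF c 1 2, of "Min D"] tangent_angles_step[OF c 2 1, of "Min D"] agree
    by blast
qed

section \<open>Facets of the hull of rings of points\<close>

text \<open>Up to an isometry fixing the origin, \<open>w i \<phi>\<close> is the point at angular distance \<open>\<phi>\<close> from the
  apex \<open>w i 0\<close> on the half-meridian through the vertex \<open>i\<close> of the equatorial \<open>l\<close>-gon; the angles
  in \<open>\<Phi>\<close> are those of the parallels \<open>L\<^sub>i\<close>.\<close>

locale dual_rings =
  fixes w :: "nat \<Rightarrow> real \<Rightarrow> real^3" and l :: nat and \<Phi> :: "real set" and r :: real
    and V P :: "(real^3) set"
  assumes odd_l: "odd l" and l_ge: "3 \<le> l"
    and fin_\<Phi>: "finite \<Phi>" and \<Phi>_sub: "\<Phi> \<subseteq> {0<..pi}"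
    and inner_w: "w i \<phi> \<bullet> w j \<psi> =
      cos \<phi> * cos \<psi> + sin \<phi> * sin \<psi> * cos (2 * pi * (real i - real j) / l)"
    and V_eq: "V = {w i \<phi> |i \<phi>. i < l \<and> \<phi> \<in> insert 0 \<Phi>}"
    and P_eq: "P = convex hull V"
    and r: "0 < r" "r < 1" "cball 0 r \<subseteq> P"
    and dual_ge: "v \<in> V \<Longrightarrow> x \<in> P \<Longrightarrow> - r \<le> v \<bullet> x"
    and dual_facet: "v \<in> V \<Longrightarrow> (P \<inter> {x. v \<bullet> x = - r}) facet_of P"
    and facet_dual: "F facet_of P \<Longrightarrow> \<exists>v\<in>V. F = P \<inter> {x. v \<bullet> x = - r}"
    and facet_touches: "F facet_of P \<Longrightarrow> \<exists>x\<in>F. norm x = r"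
begin

section \<open>Points on the rings and their polar angles\<close>

abbreviation c :: real where "c \<equiv> cos (pi / l)"

lemma c_pos: "0 < c"
proof -
  have "pi / l \<le> pi / 3" using l_ge by (intro divide_left_mono) auto
  moreover have "pi / 3 < pi / 2" by simp
  ultimately have "pi / l < pi / 2" by linarith
  moreover have "0 \<le> pi / l" by simp
  ultimately show ?thesis using pi_gt_zero by (intro cos_gt_zero_pi) linarith+
qed

lemma norm_w: "norm (w i \<phi>) = 1"
  using inner_w[of i \<phi> i \<phi>] by (simp add: norm_eq_sqrt_inner flip: power2_eq_square)

text \<open>The points are known only through their scalar products, so equality is deduced from
  scalar product 1 of unit vectors. Indices may thus run past l without reduction.\<close>

lemma w_cong:
  assumes "int i mod l = int j mod l"
  shows "w i \<phi> = w j \<phi>"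
proof -
  have "int l dvd int i - int j" using assms by (simp only: mod_eq_dvd_iff)
  then obtain q where q: "int i - int j = int l * q" by (rule dvdE)
  have "real i - real j = of_int (int i - int j)" by simp
  also have "\<dots> = l * of_int q" unfolding q by simp
  finally have "2 * pi * (real i - real j) / l = 2 * pi * of_int q" using l_ge by simp
  then have "w i \<phi> \<bullet> w j \<phi> = 1"
    unfolding inner_w by (simp flip: power2_eq_square)
  then show ?thesis using inner_eq_1_imp_eq norm_w by (metis order_refl)
qed

lemma w_0: "w i 0 = w j 0"
proof -
  have "w i 0 \<bullet> w j 0 = 1" by (simp add: inner_w)
  then show ?thesis using inner_eq_1_imp_eq norm_w by (metis order_refl)
qed

lemma w_in_V:
  assumes "\<phi> \<in> insert 0 \<Phi>"
  shows "w i \<phi> \<in> V"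
proof -
  have "w i \<phi> = w (i mod l) \<phi>" by (rule w_cong) (simp add: zmod_int)
  moreover have "i mod l < l" using l_ge by simp
  ultimately show ?thesis using assms unfolding V_eq by blast
qed

lemma V_cases:
  assumes "v \<in> V"
  obtains i \<phi> where "v = w i \<phi>" "i < l" "\<phi> \<in> insert 0 \<Phi>"
  using assms V_eq by auto

lemma V_sphere: "V \<subseteq> sphere 0 1"
  by (auto elim: V_cases simp: norm_w)

lemma V_sub_P: "V \<subseteq> P"
  by (simp add: P_eq hull_subset)

lemma fin_V: "finite V"
proof -
  have "V = (\<lambda>(i, \<phi>). w i \<phi>) ` ({..<l} \<times> insert 0 \<Phi>)" by (auto simp: V_eq)
  then show ?thesis using fin_\<Phi> by simp
qed

text \<open>Angle pi would be the antipode of the apex, whose scalar product -1 with the apex is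
  below - r.\<close>

lemma angle_lt_pi:
  assumes "\<phi> \<in> insert 0 \<Phi>"
  shows "\<phi> < pi"
proof -
  have "- r \<le> w 0 0 \<bullet> w 0 \<phi>"
    using assms w_in_V V_sub_P by (intro dual_ge) auto
  then have "- r \<le> cos \<phi>" by (simp add: inner_w)
  then have "\<phi> \<noteq> pi" using r by auto
  then show ?thesis using assms \<Phi>_sub by force
qed

lemma \<Phi>_pos: "\<phi> \<in> \<Phi> \<Longrightarrow> 0 < \<phi>"
  using \<Phi>_sub by auto

lemma aff_dim_P: "aff_dim P = 3"
  using aff_dim_subset[OF r(3)] aff_dim_le_DIM[of P] aff_dim_cball[of r "0::real^3"] r(1) by simp

section \<open>Vertices of the facet dual to a given vertex\<close>

lemma vertices_of_dual_facet: "(P \<inter> {x. v \<bullet> x = - r}) \<inter> sphere 0 1 = {x \<in> V. v \<bullet> x = - r}"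
  using extreme_points_hull_sphere(2)[OF V_sphere] by (auto simp: P_eq)

lemma card_facet_ge:
  assumes "F facet_of P"
  shows "3 \<le> card (F \<inter> sphere 0 1)"
proof -
  let ?W = "F \<inter> sphere 0 1"
  have face: "F face_of convex hull V" using assms by (auto simp: P_eq intro: facet_of_imp_face_of)
  have "?W \<subseteq> V"
    using extreme_points_hull_sphere(2)[OF V_sphere] face_of_imp_subset[OF face] by auto
  then have fin: "finite ?W" using fin_V finite_subset by blast
  have "aff_dim F = 2" using assms aff_dim_P by (simp add: facet_of_def)
  then have "aff_dim ?W = 2"
  proof -
    have "affine hull F = affine hull (convex hull ?W)"
      using face_of_hull_sphere[OF fin_V V_sphere face] by (rule arg_cong)
    then have "aff_dim F = aff_dim ?W"
      by (metis aff_dim_affine_hull affine_hull_convex_hull)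
    then show ?thesis using \<open>aff_dim F = 2\<close> by simp
  qed
  then show ?thesis using aff_dim_le_card[OF fin] by simp
qed

text \<open>As l is odd, vertex j of the l-gon faces the edge from j + p to j + p + 1. On each
  parallel the scalar product with \<open>w j \<phi>\<close> is least at the ends of that edge, by
  \<open>cos_odd_multiple\<close>.\<close>

lemma opposite_edge:
  assumes "0 \<le> \<phi>" "\<phi> \<le> pi" "0 \<le> \<psi>" "\<psi> \<le> pi"
  defines "p \<equiv> l div 2"
  shows "- height c \<phi> \<psi> \<le> w j \<phi> \<bullet> w i \<psi>"
    and "w j \<phi> \<bullet> w (j + p) \<psi> = - height c \<phi> \<psi>"
    and "\<phi> \<noteq> 0 \<Longrightarrow> \<phi> \<noteq> pi \<Longrightarrow> \<psi> \<noteq> pi \<Longrightarrow> w j \<phi> \<bullet> w i \<psi> = - height c \<phi> \<psi> \<Longrightarrow>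
      w i \<psi> = w (j + p) \<psi> \<or> w i \<psi> = w (Suc (j + p)) \<psi>"
    and "w j \<phi> \<bullet> w (Suc (j + p)) \<psi> = - height c \<phi> \<psi>"
proof -
  have l2: "l = 2 * p + 1" using odd_l unfolding p_def by presburger
  \<comment> \<open>The index is shifted so that i = j + p and i = j + p + 1 become the residues 0
    and 1 modulo l.\<close>
  have eq: "w j \<phi> \<bullet> w i \<psi> =
      cos \<phi> * cos \<psi> - sin \<phi> * sin \<psi> * cos (pi * (2 * (int i - int j + int p + 1) - 1) / l)" for i
  proof -
    have "pi * (2 * (int i - int j + int p + 1) - 1) / l = pi - 2 * pi * (real j - real i) / l"
      using l_ge by (simp add: l2 field_simps)
    then have "cos (pi * (2 * (int i - int j + int p + 1) - 1) / l) = - cos (2 * pi * (real j - real i) / l)"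
      by (simp only: cos_pi_minus)
    then show ?thesis by (simp add: inner_w)
  qed
  have pos: "0 \<le> sin \<phi> * sin \<psi>" using assms by (intro mult_nonneg_nonneg sin_ge_zero)
  have "2 \<le> l" using l_ge by simp
  note odd_multiple = cos_odd_multiple[OF this]
  show "- height c \<phi> \<psi> \<le> w j \<phi> \<bullet> w i \<psi>"
    using mult_left_mono[OF odd_multiple(1) pos, of "int i - int j + int p + 1"]
    unfolding eq height_def by (simp add: algebra_simps)
  have p1: "pi * (2 * (int (j + p) - int j + int p + 1) - 1) / l = 2 * pi - (pi / l)"
    and p2: "pi * (2 * (int (Suc (j + p)) - int j + int p + 1) - 1) / l = 2 * pi + pi / l"
    using l_ge by (simp_all add: l2 field_simps)
  show "w j \<phi> \<bullet> w (j + p) \<psi> = - height c \<phi> \<psi>"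
    unfolding eq p1 height_def by (simp add: cos_diff)
  show "w j \<phi> \<bullet> w (Suc (j + p)) \<psi> = - height c \<phi> \<psi>"
    unfolding eq p2 height_def by (simp add: cos_add)
  assume *: "\<phi> \<noteq> 0" "\<phi> \<noteq> pi" "\<psi> \<noteq> pi" "w j \<phi> \<bullet> w i \<psi> = - height c \<phi> \<psi>"
  show "w i \<psi> = w (j + p) \<psi> \<or> w i \<psi> = w (Suc (j + p)) \<psi>"
  proof (cases "\<psi> = 0")
    case True
    show ?thesis unfolding True by (rule disjI1, rule w_0)
  next
    case False
    let ?k = "int i - int j + int p + 1"
    have "0 < sin \<phi>" "0 < sin \<psi>" using assms * False by (auto intro: sin_gt_zero)
    then have "cos (pi * (2 * ?k - 1) / l) = c"
      using *(4) unfolding eq height_def by simp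
    then have "?k mod l = 0 \<or> ?k mod l = 1" using odd_multiple(2) by blast
    then have "int l dvd ?k \<or> int l dvd ?k - 1"
      using \<open>2 \<le> l\<close> mod_eq_dvd_iff[of ?k "int l" 1] by (auto simp: dvd_eq_mod_eq_0)
    moreover have "int i - int (j + p) = ?k - int l" "int i - int (Suc (j + p)) = ?k - 1 - int l"
      by (simp_all add: l2)
    ultimately have "int l dvd int i - int (j + p) \<or> int l dvd int i - int (Suc (j + p))"
      using dvd_diff[OF _ dvd_refl, of "int l"] by presburger
    then have "int i mod l = int (j + p) mod l \<or> int i mod l = int (Suc (j + p)) mod l"
      by (simp only: mod_eq_dvd_iff)
    then show ?thesis using w_cong by blast
  qed
qed

text \<open>The scalar product of the apex with a point is the cosine of its polar angle, so the
  dual facet picks out one whole parallel; as all cosines are at least - r, it is the lowest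
  one.\<close>

lemma north_facet_vertices:
  obtains m where "m \<in> \<Phi>" "cos m = - r" "\<forall>\<psi>\<in>\<Phi>. \<psi> \<le> m"
    "{x \<in> V. w j 0 \<bullet> x = - r} = (\<lambda>i. w i m) ` {..<l}"
proof -
  have N: "w j 0 \<bullet> w i \<psi> = cos \<psi>" for i \<psi> by (simp add: inner_w)
  have "(P \<inter> {x. w j 0 \<bullet> x = - r}) facet_of P" by (intro dual_facet w_in_V) simp
  from card_facet_ge[OF this] have "card {x \<in> V. w j 0 \<bullet> x = - r} \<noteq> 0"
    by (simp add: vertices_of_dual_facet)
  then have "{x \<in> V. w j 0 \<bullet> x = - r} \<noteq> {}" by (metis card.empty)
  then obtain x where x: "x \<in> V" "w j 0 \<bullet> x = - r" by auto
  from V_cases[OF x(1)] obtain i m where im: "x = w i m" "m \<in> insert 0 \<Phi>" .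
  then have m: "m \<in> insert 0 \<Phi>" "cos m = - r" using x(2) N by auto
  then have "m \<in> \<Phi>" using r by auto
  have le: "\<psi> \<le> m" if "\<psi> \<in> \<Phi>" for \<psi>
  proof (rule ccontr)
    assume "\<not> \<psi> \<le> m"
    then have "cos \<psi> < cos m"
      using \<Phi>_pos[OF \<open>m \<in> \<Phi>\<close>] angle_lt_pi[of \<psi>] that by (intro cos_monotone_0_pi) auto
    moreover have "- r \<le> w j 0 \<bullet> w 0 \<psi>" using that w_in_V V_sub_P by (intro dual_ge) auto
    ultimately show False using m N by simp
  qed
  have eq: "\<psi> = m" if "\<psi> \<in> insert 0 \<Phi>" "cos \<psi> = - r" for \<psi>
  proof -
    have "0 \<le> \<psi>" "\<psi> \<le> pi" using that(1) \<Phi>_sub by auto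
    moreover have "0 \<le> m" "m \<le> pi" using m(1) \<Phi>_sub by auto
    ultimately show ?thesis using cos_inj_pi that(2) m(2) by simp
  qed
  have "{x \<in> V. w j 0 \<bullet> x = - r} = (\<lambda>i. w i m) ` {..<l}"
  proof (intro equalityI subsetI)
    fix x assume x: "x \<in> {x \<in> V. w j 0 \<bullet> x = - r}"
    then have "x \<in> V" by simp
    then obtain i \<psi> where i: "x = w i \<psi>" "i < l" "\<psi> \<in> insert 0 \<Phi>" by (rule V_cases)
    then have "\<psi> = m" using x N by (intro eq) auto
    then show "x \<in> (\<lambda>i. w i m) ` {..<l}" using i by auto
  qed (use m w_in_V[OF m(1)] N in auto)
  then show thesis using that \<open>m \<in> \<Phi>\<close> m le by blast
qed

text \<open>Each parallel contributes at most the ends of the opposite edge, and by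
  \<open>height_level_3\<close> at most two parallels contribute; a facet needs three vertices, so
  exactly two do. For A = 0 the first two listed points coincide with the apex.\<close>

lemma side_facet_vertices:
  assumes \<phi>: "\<phi> \<in> \<Phi>"
  obtains A B i where "A \<in> insert 0 \<Phi>" "B \<in> \<Phi>" "A < B"
    "height c \<phi> A = r" "height c \<phi> B = r" "sin A \<noteq> sin B"
    "{x \<in> V. w j \<phi> \<bullet> x = - r} = {w i A, w (Suc i) A, w i B, w (Suc i) B}"
proof -
  define i where "i = j + l div 2"
  have \<phi>b: "0 < \<phi>" "\<phi> < pi" using \<phi> \<Phi>_pos angle_lt_pi by auto
  have \<psi>b: "0 \<le> \<psi>" "\<psi> < pi" if "\<psi> \<in> insert 0 \<Phi>" for \<psi>
    using that \<Phi>_pos angle_lt_pi by force+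
  note opp = opposite_edge[of \<phi> _ j, folded i_def]
  \<comment> \<open>Evaluating \<open>dual_ge\<close> at the opposite edge bounds the height on
    every parallel; the facet meets only those where r is attained.\<close>
  have le: "height c \<phi> \<psi> \<le> r" if "\<psi> \<in> insert 0 \<Phi>" for \<psi>
  proof -
    have "- r \<le> w j \<phi> \<bullet> w i \<psi>"
      using that w_in_V \<phi> V_sub_P by (intro dual_ge) auto
    then show ?thesis using opp(2)[of \<psi>] \<psi>b[OF that] \<phi>b by simp
  qed
  define S where "S = {\<psi> \<in> insert 0 \<Phi>. height c \<phi> \<psi> = r}"
  have W: "{x \<in> V. w j \<phi> \<bullet> x = - r} = (\<Union>\<psi>\<in>S. {w i \<psi>, w (Suc i) \<psi>})"
  proof (intro equalityI subsetI)
    fix x assume x: "x \<in> {x \<in> V. w j \<phi> \<bullet> x = - r}"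
    then obtain k \<psi> where k: "x = w k \<psi>" "\<psi> \<in> insert 0 \<Phi>" by (auto elim: V_cases)
    then have "w j \<phi> \<bullet> w k \<psi> = - r" using x by simp
    moreover note opp(1)[of \<psi> k]
    ultimately have h: "height c \<phi> \<psi> = r" using le[OF k(2)] \<phi>b \<psi>b[OF k(2)] by simp
    then have "x = w i \<psi> \<or> x = w (Suc i) \<psi>"
      using opp(3)[of \<psi> k] \<phi>b \<psi>b[OF k(2)] \<open>w j \<phi> \<bullet> w k \<psi> = - r\<close> k(1) by simp
    then show "x \<in> (\<Union>\<psi>\<in>S. {w i \<psi>, w (Suc i) \<psi>})" using h k(2) S_def by auto
  next
    fix x assume "x \<in> (\<Union>\<psi>\<in>S. {w i \<psi>, w (Suc i) \<psi>})"
    then obtain \<psi> where \<psi>: "\<psi> \<in> insert 0 \<Phi>" "height c \<phi> \<psi> = r" "x = w i \<psi> \<or> x = w (Suc i) \<psi>"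
      by (auto simp: S_def)
    then show "x \<in> {x \<in> V. w j \<phi> \<bullet> x = - r}"
      using opp(2,4)[of \<psi>] \<phi>b \<psi>b[OF \<psi>(1)] w_in_V[OF \<psi>(1)] by auto
  qed
  have "(P \<inter> {x. w j \<phi> \<bullet> x = - r}) facet_of P" by (intro dual_facet w_in_V) (simp add: \<phi>)
  from card_facet_ge[OF this] have card: "3 \<le> card (\<Union>\<psi>\<in>S. {w i \<psi>, w (Suc i) \<psi>})"
    by (simp only: vertices_of_dual_facet W)
  have "\<exists>A B. A \<in> S \<and> B \<in> S \<and> A < B"
  proof (rule ccontr)
    assume "\<not> ?thesis"
    then have "A = B" if "A \<in> S" "B \<in> S" for A B using that by (meson linorder_neqE)
    then have "\<exists>a. S \<subseteq> {a}" by blast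
    then obtain a where "S \<subseteq> {a}" by blast
    then have "card (\<Union>\<psi>\<in>S. {w i \<psi>, w (Suc i) \<psi>}) \<le> card {w i a, w (Suc i) a}"
      by (intro card_mono) auto
    then show False using card card_insert_le_m1[of 2 "{w (Suc i) a}" "w i a"] by simp
  qed
  then obtain A B where AB: "A \<in> S" "B \<in> S" "A < B" by blast
  then have ABp: "A \<in> insert 0 \<Phi>" "B \<in> insert 0 \<Phi>" "height c \<phi> A = r" "height c \<phi> B = r"
    by (auto simp: S_def)
  have "S = {A, B}"
  proof (intro equalityI subsetI)
    fix \<psi> assume "\<psi> \<in> S"
    then have "\<psi> \<in> insert 0 \<Phi>" "height c \<phi> \<psi> = r" by (auto simp: S_def)
    then show "\<psi> \<in> {A, B}"
      using height_level_3[OF c_pos \<phi>b, of A B \<psi> r] ABp AB(3) \<psi>b[of A] \<psi>b[of B] \<psi>b[of \<psi>] by auto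
  qed (use AB in auto)
  then have W': "{x \<in> V. w j \<phi> \<bullet> x = - r} = {w i A, w (Suc i) A, w i B, w (Suc i) B}"
    unfolding W by auto
  have "B \<in> \<Phi>" using AB(3) ABp \<psi>b(1)[of A] by auto
  \<comment> \<open>A rectangular facet would be parallel to the axis, so the vertex dual to it would lie on the
    equator, on a parallel strictly between the two consecutive ones that bound the facet.\<close>
  have "sin A \<noteq> sin B"
  proof
    assume sin: "sin A = sin B"
    have cosAB: "cos B < cos A"
      using \<psi>b[OF ABp(1)] \<psi>b[OF ABp(2)] AB(3) by (intro cos_monotone_0_pi) auto
    have "cos \<phi> * (cos A - cos B) = 0"
      using ABp(3,4) sin by (simp add: height_def algebra_simps)
    then have "cos \<phi> = 0" using cosAB by simp
    then have "\<phi> = pi / 2" using cos_inj_pi[of \<phi> "pi / 2"] \<phi>b by simp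
    have "(cos A)\<^sup>2 = (cos B)\<^sup>2" using sin by (simp add: cos_squared_eq)
    then have "cos A = - cos B" using cosAB by (simp add: power2_eq_iff)
    then have "cos A = cos (pi - B)" by simp
    then have "A = pi - B" using cos_inj_pi[of A "pi - B"] \<psi>b[OF ABp(1)] \<psi>b[OF ABp(2)] by simp
    then have "A < \<phi>" "\<phi> < B" using \<open>\<phi> = pi / 2\<close> AB(3) by simp_all
    then have "r < height c \<phi> \<phi>"
      using height_between[OF c_pos \<phi>b, of A \<phi> B r] \<psi>b[OF ABp(1)] \<psi>b[OF ABp(2)] ABp by simp
    then show False using le[of \<phi>] \<phi> by simp
  qed
  then show thesis using that ABp \<open>B \<in> \<Phi>\<close> AB(3) W' by blast
qed

abbreviation \<kappa> :: real where "\<kappa> \<equiv> cos (2 * pi / l)"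

lemma angle_bounds:
  assumes "\<phi> \<in> insert 0 \<Phi>"
  shows "0 \<le> \<phi>" "\<phi> < pi"
  using assms \<Phi>_pos angle_lt_pi[OF assms] by force+

lemma facet_cases [consumes 1, case_names base side]:
  assumes "F facet_of P"
  obtains m where "m \<in> \<Phi>" "cos m = - r" "F \<inter> sphere 0 1 = (\<lambda>i. w i m) ` {..<l}"
  | A B i \<phi> where "A \<in> insert 0 \<Phi>" "B \<in> \<Phi>" "A < B" "0 < \<phi>" "\<phi> < pi"
    "height c \<phi> A = r" "height c \<phi> B = r" "sin A \<noteq> sin B"
    "F \<inter> sphere 0 1 = {w i A, w (Suc i) A, w i B, w (Suc i) B}"
proof -
  obtain v where v: "v \<in> V" "F = P \<inter> {x. v \<bullet> x = - r}" using facet_dual[OF assms] by blast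
  have W: "F \<inter> sphere 0 1 = {x \<in> V. v \<bullet> x = - r}" unfolding v(2) by (rule vertices_of_dual_facet)
  obtain j \<phi> where j: "v = w j \<phi>" "\<phi> \<in> insert 0 \<Phi>" using v(1) by (rule V_cases)
  show thesis
  proof (cases "\<phi> = 0")
    case True
    obtain m where m: "m \<in> \<Phi>" "cos m = - r"
        "{x \<in> V. w j 0 \<bullet> x = - r} = (\<lambda>i. w i m) ` {..<l}"
      using north_facet_vertices[of j] .
    show ?thesis by (rule that(1)[OF m(1,2)]) (simp only: W j(1) True m(3))
  next
    case False
    then have \<phi>: "\<phi> \<in> \<Phi>" using j by simp
    obtain A B i where AB: "A \<in> insert 0 \<Phi>" "B \<in> \<Phi>" "A < B"
      "height c \<phi> A = r" "height c \<phi> B = r" "sin A \<noteq> sin B"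
      "{x \<in> V. w j \<phi> \<bullet> x = - r} = {w i A, w (Suc i) A, w i B, w (Suc i) B}"
      using side_facet_vertices[OF \<phi>, of j] .
    show ?thesis
      by (rule that(2)[OF AB(1-3) \<Phi>_pos[OF \<phi>] angle_bounds(2)[OF j(2)] AB(4-6)])
        (simp only: W j(1) AB(7))
  qed
qed

section \<open>Facets joining consecutive parallels\<close>

lemma w_angle_inj:
  assumes "w i A = w j B" "0 \<le> A" "A \<le> pi" "0 \<le> B" "B \<le> pi"
  shows "A = B"
proof -
  have "w 0 0 \<bullet> w i A = w 0 0 \<bullet> w j B" using assms by simp
  then have "cos A = cos B" by (simp add: inner_w)
  then show ?thesis using assms(2-) cos_inj_pi by blast
qed

lemma w_index_inj:
  assumes "w i A = w j A" "0 < A" "A < pi"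
  shows "int i mod l = int j mod l"
proof -
  have "w i A \<bullet> w j A = 1" using assms(1) norm_w by (simp add: dot_square_norm)
  then have "(sin A)\<^sup>2 * cos (2 * pi * (real i - real j) / l) = 1 - (cos A)\<^sup>2"
    by (simp add: inner_w power2_eq_square)
  then have "(sin A)\<^sup>2 * cos (2 * pi * (real i - real j) / l) = (sin A)\<^sup>2" by (simp add: sin_squared_eq)
  moreover have "sin A \<noteq> 0" using sin_gt_zero[of A] assms by simp
  ultimately have "cos (2 * pi * (real i - real j) / l) = 1" by simp
  then obtain n :: int where "2 * pi * (real i - real j) / l = n * 2 * pi"
    by (auto simp: cos_one_2pi_int)
  then have "(2 * pi) * (real i - real j) = (2 * pi) * (n * l)"
    using l_ge by (simp add: divide_eq_eq mult_ac)
  then have "real i - real j = n * l" by (simp only: mult_cancel_left) simp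
  then have "real_of_int (int i - int j) = real_of_int (n * int l)" by simp
  then have "int i - int j = n * int l" by (simp only: of_int_eq_iff)
  then show ?thesis by (simp add: mod_eq_dvd_iff)
qed

lemma w_Suc_neq:
  assumes "0 < A" "A < pi"
  shows "w i A \<noteq> w (Suc i) A"
proof
  assume "w i A = w (Suc i) A"
  then have "int i mod l = int (Suc i) mod l" by (rule w_index_inj) fact+
  then have "int l dvd int i - int (Suc i)" by (simp only: mod_eq_dvd_iff)
  then show False using l_ge by simp
qed

text \<open>A supporting normal of the face spanned by one edge at polar angle \<open>M - D\<close> and the parallel
  edge at polar angle \<open>M + D\<close>.\<close>

definition face_normal :: "real \<Rightarrow> real^3" where
  "face_normal M = (c * cos M) *\<^sub>R w 0 0 + (sin M / (2 * c)) *\<^sub>R (w 0 (pi / 2) + w 1 (pi / 2))"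

lemma inner_face_normal:
  "face_normal M \<bullet> w k \<psi> = c * cos M * cos \<psi> + sin M * sin \<psi> * cos (pi * (2 * int k - 1) / l)"
proof -
  \<comment> \<open>Half-sum and half-difference for the sum-to-product formula: the ends 0 and 1 of
    the edge combine to its midpoint direction with a factor 2 c, which the normalisation of
    \<open>face_normal\<close> cancels.\<close>
  have "(2 * pi * (real 0 - real k) / l + 2 * pi * (real 1 - real k) / l) / 2 = - (pi * (2 * int k - 1) / l)"
    "(2 * pi * (real 0 - real k) / l - 2 * pi * (real 1 - real k) / l) / 2 = - (pi / l)"
    using l_ge by (simp_all add: field_simps)
  then have "cos (2 * pi * (real 0 - real k) / l) + cos (2 * pi * (real 1 - real k) / l)
      = 2 * cos (pi * (2 * int k - 1) / l) * c"
    by (simp only: cos_plus_cos cos_minus)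
  moreover have "face_normal M \<bullet> w k \<psi> = c * cos M * cos \<psi> + sin M / (2 * c) * sin \<psi> *
      (cos (2 * pi * (real 0 - real k) / l) + cos (2 * pi * (real 1 - real k) / l))"
    unfolding face_normal_def inner_add_left inner_scaleR_left inner_w by (simp add: algebra_simps)
  ultimately show ?thesis using c_pos by simp
qed

lemma inner_face_normal_le:
  assumes "0 \<le> M" "M \<le> pi" "0 \<le> \<psi>" "\<psi> \<le> pi"
  shows "face_normal M \<bullet> w k \<psi> \<le> c * cos (\<psi> - M)"
proof -
  have "0 \<le> sin M * sin \<psi>" using assms by (intro mult_nonneg_nonneg sin_ge_zero)
  moreover have "cos (pi * (2 * int k - 1) / l) \<le> c" using l_ge by (intro cos_odd_multiple(1)) simp
  ultimately show ?thesis
    using mult_left_mono unfolding inner_face_normal cos_diff by (fastforce simp: algebra_simps)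
qed

lemma inner_face_normal_edge:
  "face_normal M \<bullet> w 0 \<psi> = c * cos (\<psi> - M)" "face_normal M \<bullet> w 1 \<psi> = c * cos (\<psi> - M)"
  by (simp_all add: inner_face_normal cos_diff algebra_simps)

lemma P_sub_halfspace:
  assumes "\<And>k \<psi>. \<psi> \<in> insert 0 \<Phi> \<Longrightarrow> n \<bullet> w k \<psi> \<le> d"
  shows "P \<subseteq> {x. n \<bullet> x \<le> d}"
  unfolding P_eq
proof (rule hull_minimal)
  show "V \<subseteq> {x. n \<bullet> x \<le> d}"
  proof
    fix v assume "v \<in> V"
    then obtain i \<phi> where "v = w i \<phi>" "\<phi> \<in> insert 0 \<Phi>" by (rule V_cases)
    then show "v \<in> {x. n \<bullet> x \<le> d}" using assms by simp
  qed
qed (rule convex_halfspace_le)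

text \<open>Projected along the axis, P lies in the equatorial l-gon, whose sides have distance c
  from the centre. The unit normal of one side gives a halfspace around P, and it must contain the
  ball of radius r.\<close>

lemma inradius_le: "r \<le> c"
proof -
  let ?n = "face_normal (pi / 2)"
  have "?n \<bullet> w 0 (pi / 2) = c" "?n \<bullet> w 1 (pi / 2) = c"
    using inner_face_normal_edge[of "pi / 2" "pi / 2"] by simp_all
  then have "?n \<bullet> ?n = 1" 
    using c_pos by (subst (2) face_normal_def) (simp add: inner_add_right)
  then have nn: "?n \<bullet> ?n = 1" "norm ?n = 1" by (simp_all add: norm_eq_sqrt_inner)
  have "P \<subseteq> {x. ?n \<bullet> x \<le> c}"
  proof (rule P_sub_halfspace)
    fix k \<psi> assume "\<psi> \<in> insert 0 \<Phi>"
    then have "?n \<bullet> w k \<psi> \<le> c * cos (\<psi> - pi / 2)"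
      using angle_bounds[of \<psi>] by (intro inner_face_normal_le) auto
    also have "\<dots> \<le> c * 1" using c_pos by (intro mult_left_mono) auto
    finally show "?n \<bullet> w k \<psi> \<le> c" by simp
  qed
  moreover have "r *\<^sub>R ?n \<in> P" using r nn by (intro subsetD[OF r(3)]) simp
  ultimately show ?thesis using nn by auto
qed

text \<open>Duality yields facets but does not show that neighbouring parallels share one. With M
  the mean of A and B and D half their difference, no angle of \<Phi> is closer to M than D, so
  \<open>face_normal M\<close> supports P along an edge on each of the two parallels.\<close>

lemma consecutive_angles_facet:
  assumes A: "A \<in> insert 0 \<Phi>" and B: "B \<in> \<Phi>" and "A < B" and cons: "\<And>\<psi>. \<psi> \<in> \<Phi> \<Longrightarrow> \<psi> \<le> A \<or> B \<le> \<psi>"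
  obtains F where "F facet_of P" "w 0 A \<in> F" "w 0 B \<in> F"
proof
  define M D where "M = (A + B) / 2" and "D = (B - A) / 2"
  have b: "0 \<le> A" "A < pi" "0 \<le> B" "B < pi" using angle_bounds A B by auto
  have M: "0 \<le> M" "M \<le> pi" "0 < D" "D < pi / 2" using b \<open>A < B\<close> by (auto simp: M_def D_def)
  let ?n = "face_normal M"
  let ?d = "c * cos D"
  let ?F = "P \<inter> {x. ?n \<bullet> x = ?d}"
  have "P \<subseteq> {x. ?n \<bullet> x \<le> ?d}"
  proof (rule P_sub_halfspace)
    fix k \<psi> assume \<psi>: "\<psi> \<in> insert 0 \<Phi>"
    then have "?n \<bullet> w k \<psi> \<le> c * cos (\<psi> - M)"
      using angle_bounds[of \<psi>] M by (intro inner_face_normal_le) auto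
    also have "cos (\<psi> - M) = cos \<bar>\<psi> - M\<bar>" by simp
    also have "\<psi> \<le> A \<or> B \<le> \<psi>" using \<psi> cons b by auto
    then have "D \<le> M - \<psi> \<or> D \<le> \<psi> - M" by (auto simp: M_def D_def field_simps)
    then have "D \<le> \<bar>\<psi> - M\<bar>" by linarith
    then have "cos \<bar>\<psi> - M\<bar> \<le> cos D"
      using M angle_bounds[OF \<psi>] by (intro cos_monotone_0_pi_le) auto
    then have "c * cos \<bar>\<psi> - M\<bar> \<le> ?d" using c_pos by simp
    finally show "?n \<bullet> w k \<psi> \<le> ?d" .
  qed
  then have face: "?F face_of P"
    by (intro face_of_Int_supporting_hyperplane_le) (auto simp: P_eq)
  have "A - M = - D" "B - M = D" by (simp_all add: M_def D_def field_simps)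
  then have "cos (A - M) = cos D" "cos (B - M) = cos D" by simp_all
  \<comment> \<open>The third point is taken at angle B, which is positive, because the points at
    angle A coincide when A = 0.\<close>
  then have mem: "{w 0 A, w 0 B, w 1 B} \<subseteq> ?F"
    using A B w_in_V V_sub_P by (auto simp: inner_face_normal_edge[unfolded One_nat_def])
  then show "w 0 A \<in> ?F" "w 0 B \<in> ?F" by auto
  have "2 \<le> aff_dim ?F"
  proof (rule sphere_aff_dim_ge_2[OF mem norm_w norm_w norm_w])
    show "w 0 A \<noteq> w 0 B" "w 0 A \<noteq> w 1 B" using w_angle_inj[of 0 A _ B] b \<open>A < B\<close> by auto
    show "w 0 B \<noteq> w 1 B" using w_Suc_neq[of B 0] b \<open>A < B\<close> by simp
  qed
  moreover have "?n \<noteq> 0"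
  proof
    assume n0: "?n = 0"
    have "?n \<bullet> w 0 A = ?d" using mem by auto
    then have "?d = 0" unfolding n0 by simp
    then show False using c_pos cos_gt_zero[of D] M by simp
  qed
  then have "aff_dim ?F \<le> 2"
    using aff_dim_subset[of ?F "{x. ?n \<bullet> x = ?d}"] by simp
  ultimately show "?F facet_of P" using face mem aff_dim_P by (auto simp: facet_of_def)
qed

text \<open>A facet meeting two different parallels is not a base, so it is dual to a vertex off the
  apex; the polar angle of that vertex is the required \<phi>.\<close>

lemma tangent_angles: "tangent_angles c r \<Phi>"
  unfolding tangent_angles_def
proof (intro conjI ballI impI)
  show "finite \<Phi>" "\<Phi> \<subseteq> {0<..<pi}" using fin_\<Phi> \<Phi>_pos angle_lt_pi by auto
  show "\<exists>m\<in>\<Phi>. cos m = - r \<and> (\<forall>\<psi>\<in>\<Phi>. \<psi> \<le> m)" by (rule north_facet_vertices[of 0]) blast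
  fix A B assume AB: "A \<in> insert 0 \<Phi>" "B \<in> \<Phi>" "A < B" "\<forall>\<psi>\<in>\<Phi>. \<psi> \<le> A \<or> B \<le> \<psi>"
  then obtain F where F: "F facet_of P" "w 0 A \<in> F" "w 0 B \<in> F"
    using consecutive_angles_facet[of A B] by blast
  then have AF: "w 0 A \<in> F \<inter> sphere 0 1" "w 0 B \<in> F \<inter> sphere 0 1" by (auto simp: norm_w)
  have b: "0 \<le> A" "A \<le> pi" "0 \<le> B" "B \<le> pi" using angle_bounds[of A] angle_bounds[of B] AB by auto
  from F(1) show "\<exists>\<phi>>0. \<phi> < pi \<and> height c \<phi> A = r \<and> height c \<phi> B = r"
  proof (cases rule: facet_cases)
    case (base m)
    then have "0 \<le> m" "m \<le> pi" using angle_bounds[of m] by auto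
    then have "A = m" "B = m"
      using w_angle_inj[of 0 A _ m] w_angle_inj[of 0 B _ m] AF b unfolding base(3) by blast+
    then show ?thesis using AB by simp
  next
    case (side A' B' i \<phi>)
    then have b': "0 \<le> A'" "A' \<le> pi" "0 \<le> B'" "B' \<le> pi"
      using angle_bounds[of A'] angle_bounds[of B'] by auto
    have "A = A' \<or> A = B'" "B = A' \<or> B = B'"
      using AF w_angle_inj[of 0 A _ A'] w_angle_inj[of 0 A _ B']
        w_angle_inj[of 0 B _ A'] w_angle_inj[of 0 B _ B'] b b' unfolding side(9) by blast+
    then have "A = A'" "B = B'" using AB side(3) by auto
    then show ?thesis using side by blast
  qed
qed

end

section \<open>The shape of a facet\<close>

text \<open>Only scalar products occur, so that one vertex set can be compared for two polyhedra.
  Here a is the apex, h the cosine of the polar angle of b and b', and \<kappa> becomes cos (2 pi /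
  l).\<close>

definition triangle_shape :: "real \<Rightarrow> 'a::real_inner set \<Rightarrow> bool" where
  "triangle_shape \<kappa> W \<longleftrightarrow> (\<exists>a b b' h. W = {a, b, b'} \<and> distinct [a, b, b'] \<and> -1 < h \<and> h < 1 \<and>
     a \<bullet> b = h \<and> a \<bullet> b' = h \<and> b \<bullet> b' = h\<^sup>2 + (1 - h\<^sup>2) * \<kappa>)"

definition trapezoid_shape :: "real \<Rightarrow> 'a::real_inner set \<Rightarrow> bool" where
  "trapezoid_shape \<kappa> W \<longleftrightarrow> (\<exists>a a' b b' A B. W = {a, a', b, b'} \<and> distinct [a, a', b, b'] \<and>
     0 < A \<and> A < B \<and> B < pi \<and> sin A \<noteq> sin B \<and>
     a \<bullet> a' = (cos A)\<^sup>2 + (sin A)\<^sup>2 * \<kappa> \<and> b \<bullet> b' = (cos B)\<^sup>2 + (sin B)\<^sup>2 * \<kappa> \<and>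
     a \<bullet> b = cos (B - A) \<and> a' \<bullet> b' = cos (B - A) \<and>
     a \<bullet> b' = cos A * cos B + sin A * sin B * \<kappa> \<and> a' \<bullet> b = cos A * cos B + sin A * sin B * \<kappa>)"

lemma triangle_shape_card: "triangle_shape \<kappa> W \<Longrightarrow> card W = 3"
  by (auto simp: triangle_shape_def)

lemma trapezoid_shape_card: "trapezoid_shape \<kappa> W \<Longrightarrow> card W = 4"
  by (auto simp: trapezoid_shape_def)

text \<open>The value h is the one occurring twice among the three scalar products, whichever vertex
  is taken as apex; the remaining one then gives \<kappa>, as 1 - h^2 is not zero.\<close>

lemma triangle_shape_unique:
  assumes "triangle_shape \<kappa> W" "triangle_shape \<kappa>' W"
  shows "\<kappa> = \<kappa>'"
proof -
  obtain a b b' h where 1: "W = {a, b, b'}" "distinct [a, b, b']" "-1 < h" "h < 1"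
     "a \<bullet> b = h" "a \<bullet> b' = h" "b \<bullet> b' = h\<^sup>2 + (1 - h\<^sup>2) * \<kappa>"
    using assms(1) unfolding triangle_shape_def by blast
  obtain c d d' k where 2: "W = {c, d, d'}" "distinct [c, d, d']"
     "c \<bullet> d = k" "c \<bullet> d' = k" "d \<bullet> d' = k\<^sup>2 + (1 - k\<^sup>2) * \<kappa>'"
    using assms(2) unfolding triangle_shape_def by blast
  have "a = c \<or> a = d \<or> a = d'" "b = c \<or> b = d \<or> b = d'" "b' = c \<or> b' = d \<or> b' = d'"
    using 1(1) 2(1) by auto
  then have hk: "h = k \<and> b \<bullet> b' = d \<bullet> d'"
    using 1(2,5,6) 2(2-4) inner_commute[of c d] inner_commute[of c d'] inner_commute[of d d'] by auto
  then have "b \<bullet> b' = h\<^sup>2 + (1 - h\<^sup>2) * \<kappa>'" using 2(5) by simp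
  then have "(1 - h\<^sup>2) * \<kappa> = (1 - h\<^sup>2) * \<kappa>'" using 1(7) by simp
  moreover have "h\<^sup>2 < 1" using 1(3,4) by (simp add: abs_square_less_1)
  ultimately show ?thesis by simp
qed

text \<open>As the parallel sides have different lengths while the legs are equal, and so are the
  diagonals, the parallel sides are recognised among the three splittings of the vertices into
  two pairs.\<close>

lemma trapezoid_match:
  fixes a :: "'a::real_inner"
  assumes "{a, a', b, b'} = {c, c', d, d'}" "distinct [a, a', b, b']" "distinct [c, c', d, d']"
    and "a \<bullet> a' \<noteq> b \<bullet> b'" "a \<bullet> b = a' \<bullet> b'" "a \<bullet> b' = a' \<bullet> b" "a \<bullet> b' < a \<bullet> b"
    and "c \<bullet> c' \<noteq> d \<bullet> d'" "c \<bullet> d = c' \<bullet> d'" "c \<bullet> d' = c' \<bullet> d" "c \<bullet> d' < c \<bullet> d"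
  shows "a \<bullet> a' + b \<bullet> b' = c \<bullet> c' + d \<bullet> d'" "a \<bullet> b = c \<bullet> d" "a \<bullet> b' = c \<bullet> d'"
proof -
  have com: "c' \<bullet> c = c \<bullet> c'" "d \<bullet> c = c \<bullet> d" "d' \<bullet> c = c \<bullet> d'" "d \<bullet> c' = c' \<bullet> d" "d' \<bullet> c' = c' \<bullet> d'"
    "d' \<bullet> d = d \<bullet> d'" by (simp_all add: inner_commute)
  have "a \<in> {c, c', d, d'}" "a' \<in> {c, c', d, d'}" "b \<in> {c, c', d, d'}" "b' \<in> {c, c', d, d'}"
    using assms(1) by auto
  then have "a \<bullet> a' + b \<bullet> b' = c \<bullet> c' + d \<bullet> d' \<and> a \<bullet> b = c \<bullet> d \<and> a \<bullet> b' = c \<bullet> d'"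
    using assms(2-) com by (elim insertE emptyE) (simp_all)
  then show "a \<bullet> a' + b \<bullet> b' = c \<bullet> c' + d \<bullet> d'" "a \<bullet> b = c \<bullet> d" "a \<bullet> b' = c \<bullet> d'" by auto
qed

text \<open>Two labellings may exchange the parallel sides, so only the sum of their scalar products
  is used; with leg and diagonal it gives a linear equation for \<kappa> with nonzero
  coefficient.\<close>

lemma trapezoid_shape_unique:
  assumes "trapezoid_shape \<kappa> W" "trapezoid_shape \<kappa>' W" "\<kappa> < 1" "\<kappa>' < 1"
  shows "\<kappa> = \<kappa>'"
proof -
  obtain a a' b b' A B where W: "W = {a, a', b, b'}" "distinct [a, a', b, b']"
     and AB: "0 < A" "A < B" "B < pi" "sin A \<noteq> sin B"
     and p: "a \<bullet> a' = (cos A)\<^sup>2 + (sin A)\<^sup>2 * \<kappa>" "b \<bullet> b' = (cos B)\<^sup>2 + (sin B)\<^sup>2 * \<kappa>"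
     and e: "a \<bullet> b = cos (B - A)" "a' \<bullet> b' = cos (B - A)"
     and g: "a \<bullet> b' = cos A * cos B + sin A * sin B * \<kappa>" "a' \<bullet> b = cos A * cos B + sin A * sin B * \<kappa>"
    using assms(1) unfolding trapezoid_shape_def by blast
  obtain c c' d d' C D where W': "W = {c, c', d, d'}" "distinct [c, c', d, d']"
     and CD: "0 < C" "C < D" "D < pi" "sin C \<noteq> sin D"
     and p': "c \<bullet> c' = (cos C)\<^sup>2 + (sin C)\<^sup>2 * \<kappa>'" "d \<bullet> d' = (cos D)\<^sup>2 + (sin D)\<^sup>2 * \<kappa>'"
     and e': "c \<bullet> d = cos (D - C)" "c' \<bullet> d' = cos (D - C)"
     and g': "c \<bullet> d' = cos C * cos D + sin C * sin D * \<kappa>'" "c' \<bullet> d = cos C * cos D + sin C * sin D * \<kappa>'"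
    using assms(2) unfolding trapezoid_shape_def by blast
  \<comment> \<open>This gives \<open>\<kappa>\<close> in terms of scalar products that do not depend on the labelling.\<close>
  have "(1 - k) * (1 - (cos (y - x))\<^sup>2) = 2 - (((cos x)\<^sup>2 + (sin x)\<^sup>2 * k) + ((cos y)\<^sup>2 + (sin y)\<^sup>2 * k))
      - 2 * cos (y - x) * (cos (y - x) - (cos x * cos y + sin x * sin y * k))" for x y k :: real
  proof -
    have "(sin y * cos x - cos y * sin x)\<^sup>2 = (sin x)\<^sup>2 + (sin y)\<^sup>2
        - 2 * (cos y * cos x + sin y * sin x) * (sin x * sin y)"
      using sin_cos_squared_add[of x] sin_cos_squared_add[of y] by algebra
    moreover have "1 - (cos (y - x))\<^sup>2 = (sin y * cos x - cos y * sin x)\<^sup>2"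
      by (simp add: cos_squared_eq sin_diff)
    ultimately have h1: "1 - (cos (y - x))\<^sup>2 = (sin x)\<^sup>2 + (sin y)\<^sup>2 - 2 * cos (y - x) * (sin x * sin y)"
      by (simp add: cos_diff)
    have h2: "2 - (((cos x)\<^sup>2 + (sin x)\<^sup>2 * k) + ((cos y)\<^sup>2 + (sin y)\<^sup>2 * k))
        = (1 - k) * ((sin x)\<^sup>2 + (sin y)\<^sup>2)"
      by (simp add: cos_squared_eq algebra_simps)
    have h3: "cos (y - x) - (cos x * cos y + sin x * sin y * k) = (1 - k) * (sin x * sin y)"
      by (simp add: cos_diff algebra_simps)
    show ?thesis unfolding h1 h2 h3 by (simp add: algebra_simps)
  qed
  note key = this
  \<comment> \<open>These are the inequalities that \<open>trapezoid_match\<close> asks for: unequal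
    parallel sides, and diagonals longer than legs.\<close>
  have aux: "(cos x)\<^sup>2 + (sin x)\<^sup>2 * k \<noteq> (cos y)\<^sup>2 + (sin y)\<^sup>2 * k
      \<and> cos x * cos y + sin x * sin y * k < cos (y - x) \<and> (cos (y - x))\<^sup>2 < 1"
    if xy: "0 < x" "x < y" "y < pi" "sin x \<noteq> sin y" and k: "k < 1" for x y k :: real
  proof (intro conjI notI)
    have s: "0 < sin x" "0 < sin y" "0 < sin (y - x)" using xy by (auto intro: sin_gt_zero)
    assume "(cos x)\<^sup>2 + (sin x)\<^sup>2 * k = (cos y)\<^sup>2 + (sin y)\<^sup>2 * k"
    then have "(1 - k) * ((sin x)\<^sup>2 - (sin y)\<^sup>2) = 0" by (simp add: cos_squared_eq algebra_simps)
    then have "(sin x)\<^sup>2 = (sin y)\<^sup>2" using k by simp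
    then show False using s xy(4) by simp
  next
    have s: "0 < sin x" "0 < sin y" "0 < sin (y - x)" using xy by (auto intro: sin_gt_zero)
    have "0 < (1 - k) * (sin x * sin y)" using s k by simp
    then show "cos x * cos y + sin x * sin y * k < cos (y - x)"
      by (simp add: cos_diff algebra_simps)
    show "(cos (y - x))\<^sup>2 < 1" using s by (simp add: cos_squared_eq)
  qed
  note m = trapezoid_match[of a a' b b' c c' d d']
  have eq: "a \<bullet> a' + b \<bullet> b' = c \<bullet> c' + d \<bullet> d'" "a \<bullet> b = c \<bullet> d" "a \<bullet> b' = c \<bullet> d'"
    using m W W' p e g p' e' g' aux[OF AB assms(3)] aux[OF CD assms(4)] by metis+
  have "(1 - \<kappa>) * (1 - (cos (B - A))\<^sup>2) = 2 - (a \<bullet> a' + b \<bullet> b') - 2 * (a \<bullet> b) * (a \<bullet> b - a \<bullet> b')"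
    using key[of \<kappa> B A] p e g by simp
  also have "\<dots> = 2 - (c \<bullet> c' + d \<bullet> d') - 2 * (c \<bullet> d) * (c \<bullet> d - c \<bullet> d')"
    using eq by simp
  also have "\<dots> = (1 - \<kappa>') * (1 - (cos (D - C))\<^sup>2)"
    using key[of \<kappa>' D C] p' e' g' by simp
  finally have "(1 - \<kappa>) * (1 - (cos (B - A))\<^sup>2) = (1 - \<kappa>') * (1 - (cos (B - A))\<^sup>2)"
    using e(1) e'(1) eq(2) by simp
  then show ?thesis using aux[OF AB assms(3)] by simp
qed

context dual_rings
begin

lemma inner_ring_edge: "w i A \<bullet> w (Suc i) B = cos A * cos B + sin A * sin B * \<kappa>"
  "w (Suc i) A \<bullet> w i B = cos A * cos B + sin A * sin B * \<kappa>"
proof -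
  have "2 * pi * (real i - real (Suc i)) / l = - (2 * pi / l)" "2 * pi * (real (Suc i) - real i) / l = 2 * pi / l"
    by simp_all
  then show "w i A \<bullet> w (Suc i) B = cos A * cos B + sin A * sin B * \<kappa>"
    "w (Suc i) A \<bullet> w i B = cos A * cos B + sin A * sin B * \<kappa>"
    unfolding inner_w by (simp_all only: cos_minus)
qed

lemma inner_same_index: "w i A \<bullet> w i B = cos (B - A)"
  by (simp add: inner_w cos_diff)

text \<open>A base is recorded by its number of vertices; its scalar products are kept for l = 3,
  where it could be confused with a triangle at an apex.\<close>

lemma facet_shape:
  assumes "F facet_of P"
  shows "triangle_shape \<kappa> (F \<inter> sphere 0 1) \<or> trapezoid_shape \<kappa> (F \<inter> sphere 0 1) \<or>
    card (F \<inter> sphere 0 1) = l \<and>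
      (l = 3 \<longrightarrow> (\<forall>x\<in>F \<inter> sphere 0 1. \<forall>y\<in>F \<inter> sphere 0 1. x \<noteq> y \<longrightarrow> x \<bullet> y = (3 * r\<^sup>2 - 1) / 2))"
  using assms
proof (cases rule: facet_cases)
  case (base m)
  have m: "0 < m" "m < pi" using \<Phi>_pos angle_lt_pi base(1) by auto
  have "inj_on (\<lambda>i. w i m) {..<l}"
  proof (rule inj_onI)
    fix i j assume "i \<in> {..<l}" "j \<in> {..<l}" "w i m = w j m"
    then show "i = j" using w_index_inj[of i m j] m by simp
  qed
  then have "card (F \<inter> sphere 0 1) = l" unfolding base(3) by (simp add: card_image)
  moreover have "x \<bullet> y = (3 * r\<^sup>2 - 1) / 2"
    if l: "l = 3" and xy: "x \<in> F \<inter> sphere 0 1" "y \<in> F \<inter> sphere 0 1" "x \<noteq> y" for x y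
  proof -
    obtain i j where ij: "i < 3" "j < 3" "x = w i m" "y = w j m" "i \<noteq> j"
      using xy l unfolding base(3) by auto
    have c4: "cos (4 * pi / 3) = - 1 / 2"
      using cos_diff[of "2 * pi" "2 * pi / 3"] cos_120 by (simp add: field_simps)
    have c: "cos (2 * pi * (real i - real j) / 3) = - 1 / 2"
    proof -
      have "real i - real j \<in> {1, -1, 2, -2}"
        using ij(1,2,5) by (auto simp: numeral_3_eq_3 less_Suc_eq)
      then show ?thesis using cos_120 c4 cos_minus[of "2 * pi / 3"] cos_minus[of "4 * pi / 3"] by auto
    qed
    have "x \<bullet> y = (cos m)\<^sup>2 + (1 - (cos m)\<^sup>2) * (- 1 / 2)"
      unfolding ij inner_w l by (simp add: c sin_squared_eq flip: power2_eq_square)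
    then show ?thesis using base(2) by (simp add: field_simps)
  qed
  ultimately show ?thesis by blast
next
  case (side A B i \<phi>)
  have b: "0 \<le> A" "A < pi" "0 < B" "B < pi"
    using angle_bounds[OF side(1)] \<Phi>_pos angle_lt_pi side(2) by auto
  have neq: "w i A \<noteq> w j B" "w j A \<noteq> w i B" for i j
    using w_angle_inj[of _ A _ B] b side(3) by auto
  have neqB: "w i B \<noteq> w (Suc i) B" using w_Suc_neq b by simp
  show ?thesis
  proof (cases "A = 0")
    case True
    have "F \<inter> sphere 0 1 = {w i 0, w i B, w (Suc i) B}" 
      unfolding side(9) True using w_0[of i "Suc i"] by auto
    moreover have "distinct [w i 0, w i B, w (Suc i) B]" using neq neqB True by simp
    moreover have "-1 < cos B" "cos B < 1"
      using b cos_monotone_0_pi[of B pi] cos_monotone_0_pi[of 0 B] by auto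
    moreover have "w i 0 \<bullet> w i B = cos B" "w i 0 \<bullet> w (Suc i) B = cos B" by (simp_all add: inner_w)
    moreover have "w i B \<bullet> w (Suc i) B = (cos B)\<^sup>2 + (1 - (cos B)\<^sup>2) * \<kappa>"
      by (simp add: inner_ring_edge sin_squared_eq flip: power2_eq_square)
    ultimately have "triangle_shape \<kappa> (F \<inter> sphere 0 1)" unfolding triangle_shape_def by blast
    then show ?thesis by blast
  next
    case False
    then have A: "0 < A" using b by simp
    have "distinct [w i A, w (Suc i) A, w i B, w (Suc i) B]"
      using neq neqB w_Suc_neq[OF A b(2)] by simp
    then have "trapezoid_shape \<kappa> (F \<inter> sphere 0 1)"
      unfolding trapezoid_shape_def side(9)
      using A side(3,8) b(4) by (intro exI[of _ "w i A"] exI[of _ "w (Suc i) A"] exI[of _ "w i B"]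
        exI[of _ "w (Suc i) B"] exI[of _ A] exI[of _ B])
        (simp add: inner_ring_edge inner_same_index power2_eq_square)
    then show ?thesis by blast
  qed
qed

lemma \<kappa>_lt_1: "\<kappa> < 1"
proof -
  have "cos (2 * pi / l) < cos 0"
    using l_ge by (intro cos_monotone_0_pi) (auto simp: field_simps)
  then show ?thesis by simp
qed

text \<open>For l at least 4, \<kappa> is nonnegative, hence so is b \<bullet> b', which therefore
  cannot equal a negative q.\<close>

lemma equilateral_triangle_imp_degree_3:
  assumes W: "triangle_shape \<kappa> W" and q: "q < 0" "\<And>x y. x \<in> W \<Longrightarrow> y \<in> W \<Longrightarrow> x \<noteq> y \<Longrightarrow> x \<bullet> y = q"
  shows "l = 3"
proof (rule ccontr)
  assume "l \<noteq> 3"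
  then have "4 \<le> l" using l_ge by simp
  then have "2 * pi / l \<le> pi / 2" by (simp add: field_simps)
  moreover have "- (pi / 2) \<le> 2 * pi / l" by (rule order_trans[of _ 0]) simp_all
  ultimately have "0 \<le> \<kappa>" by (intro cos_ge_zero)
  obtain a b b' h where abh: "W = {a, b, b'}" "distinct [a, b, b']" "-1 < h" "h < 1"
     "a \<bullet> b = h" "a \<bullet> b' = h" "b \<bullet> b' = h\<^sup>2 + (1 - h\<^sup>2) * \<kappa>"
    using W unfolding triangle_shape_def by blast
  then have "h = q" "h\<^sup>2 + (1 - h\<^sup>2) * \<kappa> = q" using q(2)[of a b] q(2)[of b b'] by auto
  moreover have "h\<^sup>2 < 1" using abh by (simp add: abs_square_less_1)
  then have "0 \<le> (1 - h\<^sup>2) * \<kappa>" using \<open>0 \<le> \<kappa>\<close> by simp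
  ultimately show False using q(1) zero_le_power2[of h] by linarith
qed

end

section \<open>Comparing two polyhedra with a common facet\<close>

lemma facet_inradius_le:
  assumes "dual_rings w l \<Phi> r V P" "dual_rings w' l' \<Phi>' r' V' P'" "F facet_of P" "F facet_of P'"
  shows "r' \<le> r"
proof -
  interpret p: dual_rings w l \<Phi> r V P by fact
  interpret q: dual_rings w' l' \<Phi>' r' V' P' by fact
  obtain x where x: "x \<in> F" "norm x = r" using p.facet_touches assms(3) by blast
  obtain v where v: "v \<in> V'" "F = P' \<inter> {x. v \<bullet> x = - r'}" using q.facet_dual assms(4) by blast
  \<comment> \<open>The touching point x lies in a plane at distance r' from the origin, so its norm
    r is at least r'.\<close>
  then have "norm v = 1" "v \<bullet> x = - r'" using q.V_sphere x by auto
  then show ?thesis using Cauchy_Schwarz_ineq2[of v x] x q.r(1) by simp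
qed

lemma facet_equilateral_triangle_degree:
  assumes "dual_rings w l \<Phi> r V P" "dual_rings w' 3 \<Phi>' r' V' P'"
    and t: "triangle_shape (cos (2 * pi / l)) W"
    and reg: "\<forall>x\<in>W. \<forall>y\<in>W. x \<noteq> y \<longrightarrow> x \<bullet> y = (3 * r'\<^sup>2 - 1) / 2"
  shows "l = 3"
proof -
  interpret p: dual_rings w l \<Phi> r V P by fact
  interpret q: dual_rings w' 3 \<Phi>' r' V' P' by fact
  have "r' \<le> 1 / 2" using q.inradius_le by (simp add: cos_60)
  then have "r'\<^sup>2 \<le> (1 / 2)\<^sup>2" using q.r(1) by (intro power_mono) auto
  then have "(3 * r'\<^sup>2 - 1) / 2 < 0" by (simp add: power2_eq_square)
  then show ?thesis using p.equilateral_triangle_imp_degree_3[OF t] reg by blast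
qed

lemma dual_rings_unique:
  assumes "dual_rings w l \<Phi> r V P" "dual_rings w' l' \<Phi>' r' V' P'"
    and F: "F facet_of P" "F facet_of P'"
  shows "l = l'" "\<Phi> = \<Phi>'"
proof -
  interpret p: dual_rings w l \<Phi> r V P by fact
  interpret q: dual_rings w' l' \<Phi>' r' V' P' by fact
  have rr: "r = r'"
    using facet_inradius_le[OF assms(1,2) F] facet_inradius_le[OF assms(2,1) F(2,1)] by simp
  let ?W = "F \<inter> sphere 0 1"
  have inj: "l = l'" if "cos (2 * pi / l) = cos (2 * pi / l')"
  proof -
    have "2 * pi / l = 2 * pi / l'"
      using cos_inj_pi[of "2 * pi / l" "2 * pi / l'"] that p.l_ge q.l_ge by (simp add: field_simps)
    then show ?thesis using p.l_ge q.l_ge by (simp add: field_simps)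
  qed
  \<comment> \<open>A trapezoid has four vertices, and a base has an odd number.\<close>
  have four: "l \<noteq> 4" "l' \<noteq> 4" using p.odd_l q.odd_l by auto
  show "l = l'"
    using p.facet_shape[OF F(1)]
  proof (elim disjE conjE)
    assume t: "triangle_shape p.\<kappa> ?W"
    show ?thesis
      using q.facet_shape[OF F(2)]
    proof (elim disjE conjE)
      assume "triangle_shape q.\<kappa> ?W"
      then show ?thesis using triangle_shape_unique[OF t] inj by blast
    next
      assume "trapezoid_shape q.\<kappa> ?W"
      then show ?thesis using triangle_shape_card[OF t] trapezoid_shape_card by fastforce
    next
      assume b: "card ?W = l'" "l' = 3 \<longrightarrow> (\<forall>x\<in>?W. \<forall>y\<in>?W. x \<noteq> y \<longrightarrow> x \<bullet> y = (3 * r'\<^sup>2 - 1) / 2)"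
      then have "l' = 3" using triangle_shape_card[OF t] by simp
      then show ?thesis using facet_equilateral_triangle_degree[OF assms(1) assms(2)[unfolded \<open>l' = 3\<close>] t] b by simp
    qed
  next
    assume t: "trapezoid_shape p.\<kappa> ?W"
    show ?thesis
      using q.facet_shape[OF F(2)]
    proof (elim disjE conjE)
      assume "triangle_shape q.\<kappa> ?W"
      then show ?thesis using trapezoid_shape_card[OF t] triangle_shape_card by fastforce
    next
      assume "trapezoid_shape q.\<kappa> ?W"
      then show ?thesis using trapezoid_shape_unique[OF t] inj p.\<kappa>_lt_1 q.\<kappa>_lt_1 by blast
    next
      assume "card ?W = l'"
      then show ?thesis using trapezoid_shape_card[OF t] four by simp
    qed
  next
    assume b: "card ?W = l" "l = 3 \<longrightarrow> (\<forall>x\<in>?W. \<forall>y\<in>?W. x \<noteq> y \<longrightarrow> x \<bullet> y = (3 * r\<^sup>2 - 1) / 2)"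
    show ?thesis
      using q.facet_shape[OF F(2)]
    proof (elim disjE conjE)
      assume t: "triangle_shape q.\<kappa> ?W"
      then have "l = 3" using triangle_shape_card[OF t] b by simp
      then show ?thesis using facet_equilateral_triangle_degree[OF assms(2) assms(1)[unfolded \<open>l = 3\<close>] t] b by simp
    next
      assume "trapezoid_shape q.\<kappa> ?W"
      then show ?thesis using trapezoid_shape_card b four by fastforce
    next
      assume "card ?W = l'"
      then show ?thesis using b by simp
    qed
  qed
  then show "\<Phi> = \<Phi>'"
    using tangent_angles_unique[OF p.c_pos p.tangent_angles] q.tangent_angles rr by simp
qed

section \<open>The polyhedra of the construction\<close>

definition ring_point :: "nat \<Rightarrow> nat \<Rightarrow> real \<Rightarrow> real^3" where
  "ring_point l i \<phi> = vector [cos \<phi>, sin \<phi> * cos (2 * pi * i / l), sin \<phi> * sin (2 * pi * i / l)]"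

definition ring_vertices :: "nat \<Rightarrow> real set \<Rightarrow> (real^3) set" where
  "ring_vertices l \<Phi> = {ring_point l i \<phi> |i \<phi>. i < l \<and> \<phi> \<in> insert 0 \<Phi>}"

text \<open>Splitting off the offset \<theta> as an isometry leaves a model depending only on l and
  \<Phi>.\<close>

definition axis_rotation :: "real \<Rightarrow> real^3 \<Rightarrow> real^3" where
  "axis_rotation \<theta> x = vector [x $ 1, cos \<theta> * x $ 2 - sin \<theta> * x $ 3, sin \<theta> * x $ 2 + cos \<theta> * x $ 3]"

lemma inner_ring_point:
  "ring_point l i \<phi> \<bullet> ring_point l j \<psi> =
     cos \<phi> * cos \<psi> + sin \<phi> * sin \<psi> * cos (2 * pi * (real i - real j) / l)"
proof -
  have "2 * pi * (real i - real j) / l = 2 * pi * i / l - 2 * pi * j / l"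
    by (simp add: algebra_simps diff_divide_distrib)
  then show ?thesis
    by (simp only: cos_diff) (simp add: ring_point_def inner_vec_def sum_3 algebra_simps)
qed

lemma orthogonal_axis_rotation: "orthogonal_transformation (axis_rotation \<theta>)"
  unfolding orthogonal_transformation_def
proof (intro conjI allI)
  show "linear (axis_rotation \<theta>)"
    by (rule linearI) (simp_all add: axis_rotation_def vec_eq_iff forall_3 algebra_simps)
  fix v w :: "real^3"
  have "(c * a - s * b) * (c * d - s * e) + (s * a + c * b) * (s * d + c * e) = a * d + b * e"
    if "c * c + s * s = 1" for a b c d e s :: real
    using that by algebra
  from this[of "cos \<theta>" "sin \<theta>" "v $ 2" "v $ 3" "w $ 2" "w $ 3"]
  show "axis_rotation \<theta> v \<bullet> axis_rotation \<theta> w = v \<bullet> w"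
    by (simp add: axis_rotation_def inner_vec_def sum_3 add.assoc flip: power2_eq_square)
qed

lemma axis_rotation_ring_point:
  "axis_rotation \<theta> (ring_point l i \<phi>) =
     vector [cos \<phi>, sin \<phi> * cos (\<theta> + 2 * pi * i / l), sin \<phi> * sin (\<theta> + 2 * pi * i / l)]"
  by (simp add: axis_rotation_def ring_point_def vec_eq_iff forall_3 cos_add sin_add algebra_simps)

text \<open>The height on the axis fixes a = cos \<phi>, the unit norm gives b^2 = (sin \<phi>)^2,
  and the half-meridian fixes the sign of b.\<close>

lemma half_meridian_Int_parallel:
  assumes "\<bar>y $ 1\<bar> \<le> 1"
  defines "\<phi> \<equiv> arccos (y $ 1)"
  shows "half_meridian (vector [0, cos \<alpha>, sin \<alpha>]) \<inter> parallel_through y =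
    {vector [cos \<phi>, sin \<phi> * cos \<alpha>, sin \<phi> * sin \<alpha>]}" (is "half_meridian ?v \<inter> _ = {?p}")
proof -
  have \<phi>: "cos \<phi> = y $ 1" "0 \<le> \<phi>" "\<phi> \<le> pi"
    using assms(1) unfolding \<phi>_def by (auto intro: arccos_lbound arccos_ubound)
  then have "0 \<le> sin \<phi>" by (intro sin_ge_zero)
  have norm: "norm (vector [s, b * cos \<alpha>, b * sin \<alpha>] :: real^3) = 1 \<longleftrightarrow> s\<^sup>2 + b\<^sup>2 = 1" for s b
  proof -
    have "(vector [s, b * cos \<alpha>, b * sin \<alpha>] :: real^3) \<bullet> vector [s, b * cos \<alpha>, b * sin \<alpha>]
        = s\<^sup>2 + ((b * cos \<alpha>)\<^sup>2 + (b * sin \<alpha>)\<^sup>2)"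
      by (simp add: inner_vec_def sum_3 power2_eq_square)
    also have "(b * cos \<alpha>)\<^sup>2 + (b * sin \<alpha>)\<^sup>2 = b\<^sup>2"
      by (simp add: power_mult_distrib flip: distrib_left)
    finally show ?thesis by (simp add: norm_eq_1)
  qed
  have comb: "a *\<^sub>R north_pole + b *\<^sub>R ?v = vector [a, b * cos \<alpha>, b * sin \<alpha>]" for a b
    by (simp add: north_pole_def vec_eq_iff forall_3)
  show ?thesis
  proof (intro equalityI subsetI)
    fix p assume "p \<in> half_meridian ?v \<inter> parallel_through y"
    then obtain a b where ab: "norm p = 1" "0 \<le> b" "p = vector [a, b * cos \<alpha>, b * sin \<alpha>]" "p $ 1 = y $ 1"
      by (auto simp: half_meridian_def parallel_through_def comb)
    then have "a = cos \<phi>" using \<phi> by simp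
    moreover have "a\<^sup>2 + b\<^sup>2 = 1" using ab norm by simp
    ultimately have "b\<^sup>2 = (sin \<phi>)\<^sup>2" by (simp add: sin_squared_eq)
    then have "b = sin \<phi>" using ab(2) \<open>0 \<le> sin \<phi>\<close> by simp
    then show "p \<in> {?p}" using ab(3) \<open>a = cos \<phi>\<close> by simp
  next
    fix p assume "p \<in> {?p}"
    then have p: "p = ?p" by simp
    have "norm ?p = 1" unfolding norm by simp
    then show "p \<in> half_meridian ?v \<inter> parallel_through y"
      unfolding p half_meridian_def parallel_through_def comb
      using \<open>0 \<le> sin \<phi>\<close> \<phi>(1) by auto
  qed
qed

lemma lovasz_hull_eq:
  assumes "0 < l" and X: "\<And>i. i \<in> {1..k} \<Longrightarrow> \<bar>X i $ 1\<bar> \<le> 1"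
  obtains \<Phi> where "finite \<Phi>" "\<Phi> \<subseteq> {0<..pi}"
    "lovasz_hull r0 l \<theta> k X = convex hull (axis_rotation \<theta> ` ring_vertices l \<Phi>)"
proof
  define \<Psi> where "\<Psi> = (\<lambda>i. arccos (X i $ 1)) ` {1..k}"
  \<comment> \<open>A point at angle 0 is the pole itself, which \<open>ring_vertices\<close> adds
    back.\<close>
  let ?\<Phi> = "\<Psi> - {0}"
  let ?p = "\<lambda>j \<phi>. axis_rotation \<theta> (ring_point l j \<phi>)"
  show "finite ?\<Phi>" by (simp add: \<Psi>_def)
  have "\<Psi> \<subseteq> {0..pi}"
    using X by (auto simp: \<Psi>_def abs_le_iff intro!: arccos_lbound arccos_ubound)
  then show "?\<Phi> \<subseteq> {0<..pi}" by force
  have "half_meridian (vector [0, cos (\<theta> + 2 * pi * real j / real l), sin (\<theta> + 2 * pi * real j / real l)])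
      \<inter> parallel_through (to_circle r0 (X i)) = {?p j (arccos (X i $ 1))}" if "i \<in> {1..k}" for i j
    using half_meridian_Int_parallel[of "to_circle r0 (X i)"] X[OF that]
    by (simp add: axis_rotation_ring_point to_circle_def)
  note point = this
  have "(\<Union>v\<in>equatorial_polygon l \<theta>. \<Union>i\<in>{1..k}.
      half_meridian v \<inter> parallel_through (to_circle r0 (X i))) =
      (\<Union>j<l. \<Union>i\<in>{1..k}. {?p j (arccos (X i $ 1))})"
    unfolding equatorial_polygon_def image_image by (intro SUP_cong refl point)
  also have "\<dots> = {?p j \<phi> |j \<phi>. j < l \<and> \<phi> \<in> \<Psi>}"
    unfolding \<Psi>_def by blast
  finally have "(\<Union>v\<in>equatorial_polygon l \<theta>. \<Union>i\<in>{1..k}.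
      half_meridian v \<inter> parallel_through (to_circle r0 (X i))) = {?p j \<phi> |j \<phi>. j < l \<and> \<phi> \<in> \<Psi>}" .
  moreover
  have pole: "?p j 0 = north_pole" for j
    by (simp add: axis_rotation_ring_point north_pole_def)
  have "north_pole \<in> {?p j \<phi> |j \<phi>. j < l \<and> \<phi> \<in> insert 0 \<Psi>}"
    using \<open>0 < l\<close> by (intro CollectI exI[of _ 0]) (simp add: pole)
  then have "insert north_pole {?p j \<phi> |j \<phi>. j < l \<and> \<phi> \<in> \<Psi>} = {?p j \<phi> |j \<phi>. j < l \<and> \<phi> \<in> insert 0 \<Psi>}"
    by (auto simp: pole)
  moreover have "\<dots> = axis_rotation \<theta> ` ring_vertices l ?\<Phi>"
    unfolding ring_vertices_def insert_Diff_single by blast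
  ultimately show "lovasz_hull r0 l \<theta> k X = convex hull (axis_rotation \<theta> ` ring_vertices l ?\<Phi>)"
    unfolding lovasz_hull_def by simp
qed

text \<open>The vertices of P lie on the unit spheres about 0 and about f 0. If these centres
  differed, the vertices, and with them P, would lie in the bisecting plane of 0 and f 0, but P
  contains 0. So f fixes the origin.\<close>

lemma isometric_copy_inscribed_linear:
  fixes V :: "(real^3) set"
  assumes ssd: "strongly_self_dual P" and copy: "isometric_copy (convex hull V) P"
    and V: "V \<subseteq> sphere 0 1"
  obtains g where "orthogonal_transformation g" "P = convex hull (g ` V)"
proof -
  obtain f where f: "\<And>x y. dist (f x) (f y) = dist x y" "P = f ` (convex hull V)"
    using copy unfolding isometric_copy_def by blast
  define g where "g x = f x - f 0" for x
  have g: "orthogonal_transformation g"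
    unfolding orthogonal_transformation_isometry using f(1) by (simp add: g_def dist_norm)
  have "P = (\<lambda>x. f 0 + x) ` g ` (convex hull V)" unfolding f(2) by (auto simp: g_def image_iff)
  also have "\<dots> = convex hull ((\<lambda>x. f 0 + x) ` g ` V)"
    by (simp only: convex_hull_linear_image[OF orthogonal_transformation_linear[OF g]] convex_hull_translation)
  finally have P: "P = convex hull ((\<lambda>x. f 0 + x) ` g ` V)" .
  let ?E = "{x. x extreme_point_of P}"
  have "e \<in> {x. f 0 \<bullet> x = (f 0 \<bullet> f 0) / 2}" if "e \<in> ?E" for e
  proof -
    have "e \<in> (\<lambda>x. f 0 + x) ` g ` V" using that P extreme_point_of_convex_hull by auto
    then have "norm (e - f 0) = 1"
      using V orthogonal_transformation_norm[OF g] by auto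
    moreover have "norm e = 1" using that ssd unfolding strongly_self_dual_def by auto
    ultimately have "(e - f 0) \<bullet> (e - f 0) = 1" "e \<bullet> e = 1" by (simp_all add: dot_square_norm)
    then show ?thesis by (simp add: inner_diff_left inner_diff_right inner_commute)
  qed
  then have "convex hull ?E \<subseteq> {x. f 0 \<bullet> x = (f 0 \<bullet> f 0) / 2}"
    by (intro hull_minimal convex_hyperplane) auto
  moreover have "P = convex hull ?E"
    using ssd unfolding strongly_self_dual_def
    by (intro Krein_Milman_Minkowski polytope_imp_compact polytope_imp_convex) auto
  moreover have "0 \<in> P" using ssd unfolding strongly_self_dual_def by auto
  ultimately have "f 0 = 0" by auto
  then have "P = convex hull (g ` V)" using P by simp
  then show thesis using that g by blast
qed

lemma L_type_ssd_dual_rings: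
  assumes "L_type_ssd P"
  obtains g l \<Phi> r where "orthogonal_transformation g"
    "dual_rings (\<lambda>i \<phi>. g (ring_point l i \<phi>)) l \<Phi> r (g ` ring_vertices l \<Phi>) P"
proof -
  obtain r0 t k X l \<theta> where ssd: "strongly_self_dual P"
    and X: "\<forall>i<2 * k + 1. X i \<in> ellipse r0 \<and> tangent_side t (X i) (X (Suc i))"
    and l: "odd l" "3 \<le> l" and copy: "isometric_copy (lovasz_hull r0 l \<theta> k X) P"
    using assms unfolding L_type_ssd_def lovasz_polyhedron_def by blast
  have "\<bar>X i $ 1\<bar> \<le> 1" if "i \<in> {1..k}" for i
  proof -
    have "X i \<in> ellipse r0" using X that by simp
    then have "(X i $ 1)\<^sup>2 + (X i $ 2 / r0)\<^sup>2 = 1" by (simp only: ellipse_def mem_Collect_eq)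
    then have "(X i $ 1)\<^sup>2 \<le> 1" using zero_le_power2[of "X i $ 2 / r0"] by linarith
    then show ?thesis by (simp add: abs_square_le_1)
  qed
  then obtain \<Phi> where \<Phi>: "finite \<Phi>" "\<Phi> \<subseteq> {0<..pi}"
    "lovasz_hull r0 l \<theta> k X = convex hull (axis_rotation \<theta> ` ring_vertices l \<Phi>)"
    using lovasz_hull_eq[of l k X r0 \<theta>] l by auto
  have norm1: "norm (ring_point l i \<phi>) = 1" for i \<phi>
    using inner_ring_point[of l i \<phi> i \<phi>] by (simp add: norm_eq_1 flip: power2_eq_square)
  then have rot: "axis_rotation \<theta> ` ring_vertices l \<Phi> \<subseteq> sphere 0 1"
    using orthogonal_transformation_norm[OF orthogonal_axis_rotation]
    by (auto simp: ring_vertices_def)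
  obtain h where h: "orthogonal_transformation h" "P = convex hull (h ` axis_rotation \<theta> ` ring_vertices l \<Phi>)"
    using isometric_copy_inscribed_linear[OF ssd copy[unfolded \<Phi>(3)] rot] .
  define g where "g = h \<circ> axis_rotation \<theta>"
  have g: "orthogonal_transformation g"
    unfolding g_def by (rule orthogonal_transformation_compose[OF h(1) orthogonal_axis_rotation])
  let ?V = "g ` ring_vertices l \<Phi>"
  have P: "P = convex hull ?V" using h(2) by (simp add: g_def image_comp)
  have V: "?V \<subseteq> sphere 0 1"
    using norm1 orthogonal_transformation_norm[OF g] by (auto simp: ring_vertices_def)
  have "ring_vertices l \<Phi> = (\<lambda>(i, \<phi>). ring_point l i \<phi>) ` ({..<l} \<times> insert 0 \<Phi>)"
    by (auto simp: ring_vertices_def)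
  then have fin: "finite ?V" using \<Phi>(1) by simp
  obtain r where r: "0 < r" "r < 1" "cball 0 r \<subseteq> P"
    "\<And>v x. v \<in> ?V \<Longrightarrow> x \<in> P \<Longrightarrow> - r \<le> v \<bullet> x"
    "\<And>v. v \<in> ?V \<Longrightarrow> (P \<inter> {x. v \<bullet> x = - r}) facet_of P"
    "\<And>F. F facet_of P \<Longrightarrow> \<exists>v\<in>?V. F = P \<inter> {x. v \<bullet> x = - r}"
    "\<And>F. F facet_of P \<Longrightarrow> \<exists>x\<in>F. norm x = r"
    using ssd_facets[OF ssd fin V P] by blast
  have "dual_rings (\<lambda>i \<phi>. g (ring_point l i \<phi>)) l \<Phi> r ?V P"
  proof
    fix i j \<phi> \<psi>
    show "g (ring_point l i \<phi>) \<bullet> g (ring_point l j \<psi>) =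
      cos \<phi> * cos \<psi> + sin \<phi> * sin \<psi> * cos (2 * pi * (real i - real j) / l)"
      using g by (simp add: orthogonal_transformation_def inner_ring_point)
  qed (use l \<Phi> P r in \<open>auto simp: ring_vertices_def\<close>)
  then show thesis using that g by blast
qed

theorem theorem3:
  fixes P Q F0 :: "(real^3) set"
  assumes "L_type_ssd P" and "F0 facet_of P"
    and "L_type_ssd Q" and "F0 facet_of Q"
  shows "isometric_copy P Q"
proof -
  obtain g l \<Phi> r where 1: "orthogonal_transformation g"
    "dual_rings (\<lambda>i \<phi>. g (ring_point l i \<phi>)) l \<Phi> r (g ` ring_vertices l \<Phi>) P"
    using L_type_ssd_dual_rings[OF assms(1)] .
  obtain g' l' \<Phi>' r' where 2: "orthogonal_transformation g'"
    "dual_rings (\<lambda>i \<phi>. g' (ring_point l' i \<phi>)) l' \<Phi>' r' (g' ` ring_vertices l' \<Phi>') Q"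
    using L_type_ssd_dual_rings[OF assms(3)] .
  have eq: "l = l'" "\<Phi> = \<Phi>'" using dual_rings_unique[OF 1(2) 2(2) assms(2,4)] .
  \<comment> \<open>With equal l and \<Phi> both polyhedra are orthogonal images of one model, so
    the map goes back to it by \<open>inv g\<close> and on to Q by \<open>g'\<close>.\<close>
  let ?f = "g' \<circ> inv g"
  have f: "orthogonal_transformation ?f"
    using 1(1) 2(1) by (intro orthogonal_transformation_compose orthogonal_transformation_inv)
  have "inv g (g x) = x" for x using orthogonal_transformation_inj[OF 1(1)] by simp
  then have "?f ` g ` ring_vertices l \<Phi> = g' ` ring_vertices l' \<Phi>'" by (simp add: eq image_image)
  then have "?f ` P = Q"
    unfolding dual_rings.P_eq[OF 1(2)] dual_rings.P_eq[OF 2(2)]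
    by (simp only: convex_hull_linear_image[OF orthogonal_transformation_linear[OF f]])
  moreover have "dist (?f x) (?f y) = dist x y" for x y
    using f unfolding orthogonal_transformation_isometry by blast
  ultimately show ?thesis unfolding isometric_copy_def by blast
qed

end
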